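(* Let $T>0$ and $d\in\mathbb{N}$. Let $X\in\mathcal{K}$ be a (one-dimensional, zero mean, square-integrable) Lévy process with generating triple $(0,\sigma^2,\nu)_{h\equiv 1}$, and let $Z^{(d)}=(Z_1,\dots,Z_d)^{\mathbf{T}}$, where $$Z_k=\int_0^T X_t\,e_k(t)\,dt,\qquad e_k(t)=\sqrt{\tfrac{2}{T}}\,\sin\!\left(\tfrac{\pi}{T}\left(k-\tfrac12\right)t\right),\quad k\in\{1,\dots,d\}.$$ Then $Z^{(d)}\in\mathcal{C}$ (that is, $Z^{(d)}$ is infinitely divisible with zero mean and finite second moments), with generating triple $(\mathbf{0},\mathcal{Q},\Pi)_{h\equiv 1}$, where $\mathcal{Q}$ is the diagonal $d\times d$ matrix with diagonal entries $$q_{k,k}=\sigma^2\,\frac{T^2}{\pi^2\left(k-\frac12\right)^2},\qquad k\in\{1,\dots,d\},$$ and $\Pi$ is the measure $$\Pi(B)=\int_{(\mathbb{R}\setminus\{0\})\times[0,T]}\mathbb{I}\big(f(\mathbf{v})\in B\big)\,(\nu\times\lambda)(d\mathbf{v}),\qquad B\in\mathcal{B}_{\mathbb{R}^d\setminus\{\mathbf{0}\}},$$ where $\lambda$ is Lebesgue measure on $[0,T]$ and $f:\mathbb{R}\times[0,T]\to\mathbb{R}^d$ is the function with $k$-th component $$f_k(x,t)=\frac{\sqrt{2T}\,x}{\pi}\,\frac{\cos\left(\frac{\pi}{T}\left(k-\frac12\right)t\right)}{k-\frac12},\qquad k\in\{1,\dots,d\}.$$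
   Context: Infinitely divisible (ID) random vectors and Lévy processes: a $d$-dimensional ID random vector $\xi$ satisfies $\mathbb{E}[e^{i\langle \mathbf{z},\xi\rangle}]=e^{-\Psi_\xi(\mathbf{z})}$, $\mathbf{z}\in\mathbb{R}^d$, and a $d$-dimensional Lévy process $X$ satisfies $\mathbb{E}[e^{i\langle \mathbf{z},X_t\rangle}]=e^{-t\Psi_X(\mathbf{z})}$, where the characteristic exponent $\Psi$ has the form $$\Psi(\mathbf{z})=\tfrac12\mathbf{z}^{\mathbf{T}}Q\mathbf{z}-i\langle\mathbf{a},\mathbf{z}\rangle-\int_{\mathbb{R}^d\setminus\{\mathbf{0}\}}\left(e^{i\langle\mathbf{z},\mathbf{x}\rangle}-1-i\langle\mathbf{z},\mathbf{x}\rangle h(\mathbf{x})\right)\nu(d\mathbf{x}),$$ with $\mathbf{a}\in\mathbb{R}^d$, $Q$ positive semi-definite, and $\nu$ (the Lévy measure) a measure on $\mathbb{R}^d\setminus\{\mathbf{0}\}$ with $\int\min(1,|\mathbf{x}|^2)\,\nu(d\mathbf{x})<\infty$. The function $h$ is the cut-off function; $(\mathbf{a},Q,\nu)_{h\equiv c}$ denotes the generating triple with respect to the constant cut-off function $h\equiv c$. In dimension one the triple is written $(a,\sigma^2,\nu)_{h\equiv c}$. $\mathcal{K}$ is the set of one-dimensional Lévy processes $X$ with $\mathbb{E}[X_t]=0$ and $\mathbb{E}[X_t^2]<\infty$ for every $t\ge0$; each such process has a generating triple of the form $(0,\sigma^2,\nu)_{h\equiv1}$. $\mathcal{C}$ is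 the class of ID random vectors with zero first moment and finite (component-wise) second moment. $\mathbb{I}$ denotes the indicator, and $\mathcal{B}_S$ the Borel sigma algebra of a topological space $S$. The $e_k$ are the normalized eigenfunctions of the covariance operator of $X$ on $L^2([0,T])$, and the $Z_k$ are the stochastic coefficients of the Karhunen–Loève expansion of $X$ on $[0,T]$. *)

theory Defs
  imports "HOL-Probability.Probability"
begin

text \<open>
  Processes are indexed by \<^typ>\<open>real\<close>; only the times \<open>t \<ge> 0\<close> are ever constrained or used.
\<close>

definition cadlag :: "(real \<Rightarrow> 'v::euclidean_space) \<Rightarrow> bool" where
  "cadlag x \<longleftrightarrow>
     (\<forall>t\<ge>0. (x \<longlongrightarrow> x t) (at_right t)) \<and>
     (\<forall>t>0. \<exists>l. (x \<longlongrightarrow> l) (at_left t))"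

definition levy_process :: "'a measure \<Rightarrow> (real \<Rightarrow> 'a \<Rightarrow> 'v::euclidean_space) \<Rightarrow> bool" where
  "levy_process M X \<longleftrightarrow>
     prob_space M \<and>
     (\<forall>t\<ge>0. X t \<in> borel_measurable M) \<and>
     (AE \<omega> in M. X 0 \<omega> = 0) \<and>
     (\<forall>(n::nat) (t::nat \<Rightarrow> real). 0 \<le> t 0 \<and> (\<forall>i<n. t i < t (Suc i)) \<longrightarrow>
        prob_space.indep_vars M (\<lambda>_. borel) (\<lambda>i \<omega>. X (t (Suc i)) \<omega> - X (t i) \<omega>) {..<n}) \<and>
     (\<forall>s\<ge>0. \<forall>h\<ge>0. distr M borel (\<lambda>\<omega>. X (s + h) \<omega> - X s \<omega>) = distr M borel (X h)) \<and>
     (AE \<omega> in M. cadlag (\<lambda>t. X t \<omega>))"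

definition infinitely_divisible :: "'a measure \<Rightarrow> ('a \<Rightarrow> 'v::euclidean_space) \<Rightarrow> bool" where
  "infinitely_divisible M \<xi> \<longleftrightarrow>
     prob_space M \<and> \<xi> \<in> borel_measurable M \<and>
     (\<forall>n\<ge>1. \<exists>\<mu>. prob_space \<mu> \<and> sets \<mu> = sets borel \<and>
        distr M borel \<xi> = distr (PiM {..<n::nat} (\<lambda>_. \<mu>)) borel (\<lambda>y. \<Sum>i<n. y i))"

definition levy_measure :: "'v::euclidean_space measure \<Rightarrow> bool" where
  "levy_measure \<nu> \<longleftrightarrow>
     sets \<nu> = sets (restrict_space borel (- {0})) \<and>
     (\<integral>\<^sup>+ x. ennreal (min 1 ((norm x)\<^sup>2)) \<partial>\<nu>) < \<infinity>"

definition levy_integrand :: "('v::euclidean_space \<Rightarrow> real) \<Rightarrow> 'v \<Rightarrow> 'v \<Rightarrow> complex" where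
  "levy_integrand h z x = iexp (z \<bullet> x) - 1 - \<i> * complex_of_real (z \<bullet> x) * complex_of_real (h x)"

text \<open>
  The Gaussian covariance is passed as a linear map, so that one definition serves
  both \<^typ>\<open>real\<close> (\<open>Q z = \<sigma>\<^sup>2 * z\<close>) and \<open>real ^ 'd\<close> (\<open>Q z = A *v z\<close>).
\<close>

definition char_exponent ::
  "('v::euclidean_space \<Rightarrow> real) \<Rightarrow> 'v \<Rightarrow> ('v \<Rightarrow> 'v) \<Rightarrow> 'v measure \<Rightarrow> 'v \<Rightarrow> complex" where
  "char_exponent h a Q \<nu> z =
     complex_of_real (z \<bullet> Q z / 2) - \<i> * complex_of_real (a \<bullet> z)
       - (\<integral>x. levy_integrand h z x \<partial>\<nu>)"

text \<open>
  Integrability is required explicitly: the Bochner integral of a non-integrable function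
  is 0, so without it the exponent would be meaningless for cut-off functions such as
  \<open>h \<equiv> 1\<close>, which are not admissible for every Levy measure.
\<close>

definition generating_triple ::
  "('v::euclidean_space \<Rightarrow> real) \<Rightarrow> 'v \<Rightarrow> ('v \<Rightarrow> 'v) \<Rightarrow> 'v measure \<Rightarrow> bool" where
  "generating_triple h a Q \<nu> \<longleftrightarrow>
     linear Q \<and> (\<forall>x y. Q x \<bullet> y = x \<bullet> Q y) \<and> (\<forall>x. 0 \<le> x \<bullet> Q x) \<and>
     levy_measure \<nu> \<and> (\<forall>z. integrable \<nu> (levy_integrand h z))"

definition vector_has_triple ::
  "'a measure \<Rightarrow> ('a \<Rightarrow> 'v::euclidean_space) \<Rightarrow>
   ('v \<Rightarrow> real) \<Rightarrow> 'v \<Rightarrow> ('v \<Rightarrow> 'v) \<Rightarrow> 'v measure \<Rightarrow> bool" where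
  "vector_has_triple M \<xi> h a Q \<nu> \<longleftrightarrow>
     generating_triple h a Q \<nu> \<and>
     (\<forall>z. (\<integral>\<omega>. iexp (z \<bullet> \<xi> \<omega>) \<partial>M) = exp (- char_exponent h a Q \<nu> z))"

definition process_has_triple ::
  "'a measure \<Rightarrow> (real \<Rightarrow> 'a \<Rightarrow> 'v::euclidean_space) \<Rightarrow>
   ('v \<Rightarrow> real) \<Rightarrow> 'v \<Rightarrow> ('v \<Rightarrow> 'v) \<Rightarrow> 'v measure \<Rightarrow> bool" where
  "process_has_triple M X h a Q \<nu> \<longleftrightarrow>
     generating_triple h a Q \<nu> \<and>
     (\<forall>t\<ge>0. \<forall>z. (\<integral>\<omega>. iexp (z \<bullet> X t \<omega>) \<partial>M) =
        exp (- (complex_of_real t * char_exponent h a Q \<nu> z)))"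

definition class_K :: "'a measure \<Rightarrow> (real \<Rightarrow> 'a \<Rightarrow> real) \<Rightarrow> bool" where
  "class_K M X \<longleftrightarrow>
     levy_process M X \<and>
     (\<forall>t\<ge>0. integrable M (X t) \<and> (\<integral>\<omega>. X t \<omega> \<partial>M) = 0 \<and> integrable M (\<lambda>\<omega>. (X t \<omega>)\<^sup>2))"

definition class_C :: "'a measure \<Rightarrow> ('a \<Rightarrow> real ^ 'd) \<Rightarrow> bool" where
  "class_C M \<xi> \<longleftrightarrow>
     infinitely_divisible M \<xi> \<and>
     (\<forall>j. integrable M (\<lambda>\<omega>. \<xi> \<omega> $ j) \<and> (\<integral>\<omega>. \<xi> \<omega> $ j \<partial>M) = 0 \<and>
          integrable M (\<lambda>\<omega>. (\<xi> \<omega> $ j)\<^sup>2))"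

definition kl_eigenfunction :: "real \<Rightarrow> nat \<Rightarrow> real \<Rightarrow> real" where
  "kl_eigenfunction T k t = sqrt (2 / T) * sin (pi / T * (real k - 1 / 2) * t)"

text \<open>
  The coefficient is the pathwise integral. As paths are cadlag only almost surely, it need
  not be measurable on the exceptional null set; it is a random variable with respect to
  \<^term>\<open>completion M\<close>, on which its law is to be taken.
\<close>

definition kl_coeff :: "(real \<Rightarrow> 'a \<Rightarrow> real) \<Rightarrow> real \<Rightarrow> nat \<Rightarrow> 'a \<Rightarrow> real" where
  "kl_coeff X T k \<omega> = (LBINT t:{0..T}. X t \<omega> * kl_eigenfunction T k t)"

text \<open>
  In the following, \<open>idx\<close> numbers the coordinates of \<open>real ^ 'd\<close> by \<open>1, \<dots>, d\<close>,
  where \<open>d = CARD('d)\<close>.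
\<close>

definition kl_vector :: "('d \<Rightarrow> nat) \<Rightarrow> (real \<Rightarrow> 'a \<Rightarrow> real) \<Rightarrow> real \<Rightarrow> 'a \<Rightarrow> real ^ 'd" where
  "kl_vector idx X T \<omega> = (\<chi> j. kl_coeff X T (idx j) \<omega>)"

definition kl_covariance :: "('d \<Rightarrow> nat) \<Rightarrow> real \<Rightarrow> real \<Rightarrow> real ^ 'd ^ 'd" where
  "kl_covariance idx \<sigma> T =
     (\<chi> i j. if i = j then \<sigma>\<^sup>2 * (T\<^sup>2 / (pi\<^sup>2 * (real (idx i) - 1 / 2)\<^sup>2)) else 0)"

definition kl_kernel :: "('d \<Rightarrow> nat) \<Rightarrow> real \<Rightarrow> real \<times> real \<Rightarrow> real ^ 'd" where
  "kl_kernel idx T = (\<lambda>(x, t). \<chi> j.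
     sqrt (2 * T) * x / pi * (cos (pi / T * (real (idx j) - 1 / 2) * t) / (real (idx j) - 1 / 2)))"

definition kl_levy_measure ::
  "('d::finite \<Rightarrow> nat) \<Rightarrow> real \<Rightarrow> real measure \<Rightarrow> (real ^ 'd) measure" where
  "kl_levy_measure idx T \<nu> =
     measure_of (- {0}) (sets (restrict_space borel (- {0})))
       (\<lambda>B. \<integral>\<^sup>+ v. indicator B (kl_kernel idx T v) \<partial>(\<nu> \<Otimes>\<^sub>M restrict_space lborel {0..T}))"

lemma sets_kl_levy_measure:
  fixes idx :: "'d::finite \<Rightarrow> nat"
  shows "sets (kl_levy_measure idx T \<nu>) = sets (restrict_space borel (- {0}))"
proof -
  have "sets (restrict_space (borel :: (real ^ 'd) measure) (- {0})) \<subseteq> Pow (- {0})"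
    using sets.space_closed[of "restrict_space (borel :: (real ^ 'd) measure) (- {0})"]
    by (simp add: space_restrict_space)
  moreover have "sigma_sets (- {0}) (sets (restrict_space (borel :: (real ^ 'd) measure) (- {0})))
      = sets (restrict_space borel (- {0}))"
    using sets.sigma_sets_eq[of "restrict_space (borel :: (real ^ 'd) measure) (- {0})"]
    by (simp add: space_restrict_space)
  ultimately show ?thesis
    unfolding kl_levy_measure_def by (simp add: sets_measure_of)
qed

lemma measurable_kl_kernel:
  assumes "sets \<nu> = sets (restrict_space borel (- {0}))"
  shows "kl_kernel idx T \<in> borel_measurable (\<nu> \<Otimes>\<^sub>M restrict_space lborel {0..T})"
proof -
  let ?N = "\<nu> \<Otimes>\<^sub>M restrict_space lborel {0..T}"
  have "(\<lambda>x. x) \<in> borel_measurable \<nu>"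
    by (subst measurable_cong_sets[OF assms refl]) (rule measurable_restrict_space1, simp)
  then have [measurable]: "fst \<in> borel_measurable ?N"
    by (rule measurable_compose[OF measurable_fst])
  have "(\<lambda>x. x) \<in> borel_measurable (restrict_space lborel {0..T})"
    by (rule measurable_restrict_space1) simp
  then have [measurable]: "snd \<in> borel_measurable ?N"
    by (rule measurable_compose[OF measurable_snd])
  have "(\<lambda>v. kl_kernel idx T v $ j) \<in> borel_measurable ?N" for j
    unfolding kl_kernel_def case_prod_beta by simp
  then show ?thesis
    by (subst borel_measurable_euclidean_space)
       (auto simp: Basis_vec_def inner_axis)
qed

text \<open>The set function above is countably additive, so it is the value of \<^const>\<open>emeasure\<close>.\<close>

lemma emeasure_kl_levy_measure:
  fixes idx :: "'d::finite \<Rightarrow> nat"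
  assumes "sets \<nu> = sets (restrict_space borel (- {0}))"
    and "B \<in> sets (restrict_space borel (- {0}))"
  shows "emeasure (kl_levy_measure idx T \<nu>) B =
    (\<integral>\<^sup>+ v. indicator B (kl_kernel idx T v) \<partial>(\<nu> \<Otimes>\<^sub>M restrict_space lborel {0..T}))"
proof -
  let ?N = "\<nu> \<Otimes>\<^sub>M restrict_space lborel {0..T}"
  let ?R = "restrict_space (distr ?N borel (kl_kernel idx T)) (- {0})"
  note [measurable] = measurable_kl_kernel[OF assms(1)]
  have R: "sets ?R = sets (restrict_space borel (- {0}))"
    by (simp add: sets_restrict_space)
  have eq: "emeasure ?R A = (\<integral>\<^sup>+ v. indicator A (kl_kernel idx T v) \<partial>?N)"
    if "A \<in> sets (restrict_space borel (- {0}))" for A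
  proof -
    have A: "A \<subseteq> - {0}" and [measurable]: "A \<in> sets borel"
      using that by (auto simp: sets_restrict_space_iff)
    have "emeasure ?R A = emeasure (distr ?N borel (kl_kernel idx T)) A"
      using A by (subst emeasure_restrict_space) auto
    also have "\<dots> = (\<integral>\<^sup>+ y. indicator A y \<partial>distr ?N borel (kl_kernel idx T))"
      by simp
    also have "\<dots> = (\<integral>\<^sup>+ v. indicator A (kl_kernel idx T v) \<partial>?N)"
      by (rule nn_integral_distr) simp_all
    finally show ?thesis .
  qed
  show ?thesis
  proof (rule emeasure_measure_of[OF kl_levy_measure_def])
    show "sets (restrict_space borel (- {0})) \<subseteq> Pow (- {0 :: real ^ 'd})"
      using sets.space_closed[of "restrict_space (borel :: (real ^ 'd) measure) (- {0})"]
      by (simp add: space_restrict_space)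
    show "B \<in> sets (kl_levy_measure idx T \<nu>)"
      using assms(2) by (simp add: sets_kl_levy_measure)
    show "positive (sets (kl_levy_measure idx T \<nu>))
        (\<lambda>B. \<integral>\<^sup>+ v. indicator B (kl_kernel idx T v) \<partial>?N)"
      by (simp add: positive_def)
    show "countably_additive (sets (kl_levy_measure idx T \<nu>))
        (\<lambda>B. \<integral>\<^sup>+ v. indicator B (kl_kernel idx T v) \<partial>?N)"
      unfolding sets_kl_levy_measure countably_additive_def
    proof (intro allI impI)
      fix A :: "nat \<Rightarrow> (real ^ 'd) set"
      assume A: "range A \<subseteq> sets (restrict_space borel (- {0}))"
        "disjoint_family A" "\<Union> (range A) \<in> sets (restrict_space borel (- {0}))"
      show "(\<Sum>i. \<integral>\<^sup>+ v. indicator (A i) (kl_kernel idx T v) \<partial>?N) =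
          (\<integral>\<^sup>+ v. indicator (\<Union> (range A)) (kl_kernel idx T v) \<partial>?N)"
        using suminf_emeasure[of A ?R] A(1,2) unfolding R
        by (simp only: eq[OF range_subsetD[OF A(1)]] eq[OF A(3)])
    qed
  qed
qed

end

theory Submission
  imports Defs
begin

text \<open>
  The kernel has a second meaning: its component \<open>G\<^sub>k(t) = f\<^sub>k(1, t)\<close> is the antiderivative of
  \<open>- e\<^sub>k\<close> that vanishes at \<open>T\<close>. Integrating by parts along a path with \<open>X\<^sub>0 = 0\<close> therefore turns
  \<open>Z\<^sub>k = \<integral> X\<^sub>t e\<^sub>k(t) dt\<close> into the stochastic integral \<open>\<integral> G\<^sub>k(t) dX\<^sub>t\<close>, and the characteristic function of
  such an integral is the continuous analogue of a product over independent increments: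
  \<open>E exp(i \<langle>z, Z\<rangle>) = exp(- \<integral>\<^sub>0\<^sup>T \<Psi>\<^sub>X(\<langle>z, G(t)\<rangle>) dt)\<close>.

  Riemann sums make this precise. Since paths are right-continuous and bounded, the Riemann sums of
  \<open>\<integral> X\<^sub>t e\<^sub>k(t) dt\<close> with right endpoints converge for almost every path
  (\<open>right_endpoint_sums_tendsto_integral\<close>), and summation by parts rewrites them as the finite sums
  \<open>levy_sum\<close> of increments weighted by \<open>G\<close>. The characteristic function of such a sum is a product, whose
  exponent is a Riemann sum of \<open>\<Psi>\<^sub>X(\<langle>z, G(t)\<rangle>)\<close>; passing to the limit gives \<open>char_kl_vector\<close>.

  The exponent is then evaluated term by term. The functions \<open>G\<^sub>k\<close> are orthogonal cosines, which makes
  the Gaussian part diagonal (\<open>integral_kl_kernel_quadratic_form\<close>). As \<open>\<langle>z, f(x, t)\<rangle> = x \<langle>z, G(t)\<rangle>\<close>,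
  Fubini's theorem identifies the jump part with an integral over the image of \<open>\<nu> \<times> \<lambda>\<close> under \<open>f\<close>, which is
  \<open>\<Pi>\<close> (\<open>kl_levy_measure_integrals\<close>).

  For infinite divisibility, the process \<open>X\<^bsub>t/n\<^esub>\<close> is again a Levy process, with exponent \<open>\<Psi>\<^sub>X / n\<close>. Its own
  coefficient vector has the \<open>n\<close>-th root of the characteristic function of \<open>Z\<close>, hence supplies the law of
  the summands; this uses that characteristic functions determine laws on Euclidean spaces
  (\<open>char_unique_euclidean\<close>). The moments come from the orthogonality of the increments, which bounds the second
  moments of the approximating sums uniformly (\<open>levy_sum_second_moment_le\<close>, \<open>L2_bounded_convergence\<close>).
\<close>

section \<open>Riemann sums along cadlag paths\<close>

text \<open>
  One-sided limits bound the path near every point, and such local bounds can be glued over a compact interval.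
\<close>

lemma cadlag_bounded:
  fixes x :: "real \<Rightarrow> 'v::euclidean_space"
  assumes "cadlag x" "0 \<le> T"
  shows "bounded (x ` {0..T})"
proof -
  define P where "P a b \<longleftrightarrow> bounded (x ` ({a..b} \<inter> {0..}))" for a b
  have "P 0 T"
    using \<open>0 \<le> T\<close>
  (* bisection: the bound passes from adjacent intervals to their union and holds on short intervals *)
  proof (induction rule: Bolzano)
    case (trans a b c)
    have "x ` ({a..c} \<inter> {0..}) \<subseteq> x ` ({a..b} \<inter> {0..}) \<union> x ` ({b..c} \<inter> {0..})"
      unfolding image_Un[symmetric] by (intro image_mono) auto
    then show ?case
      using trans(1,2) unfolding P_def by (metis bounded_subset bounded_Un)
  next
    case (local t)
    have right: "\<exists>e>0. \<forall>s. t < s \<and> s < t + e \<longrightarrow> norm (x s) \<le> norm (x t) + 1"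
    proof -
      have "(x \<longlongrightarrow> x t) (at_right t)"
        using assms(1) local(1) by (simp add: cadlag_def)
      then have "eventually (\<lambda>s. dist (x s) (x t) < 1) (at_right t)"
        by (rule tendstoD) simp
      then obtain u where u: "u > t" "\<And>s. t < s \<Longrightarrow> s < u \<Longrightarrow> dist (x s) (x t) < 1"
        unfolding eventually_at_right_field by auto
      have bnd: "norm (x s) \<le> norm (x t) + 1" if "t < s" "s < u" for s
        using u(2)[OF that] norm_triangle_sub[of "x s" "x t"] by (simp add: dist_norm)
      show ?thesis
        using u(1) bnd by (intro exI[of _ "u - t"]) auto
    qed
    have left: "\<exists>e>0. \<exists>K. \<forall>s. t - e < s \<and> s < t \<and> 0 \<le> s \<longrightarrow> norm (x s) \<le> K"
    proof (cases "t = 0")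
      case True
      then show ?thesis
        by (intro exI[of _ 1]) auto
    next
      case False
      then have "t > 0"
        using local(1) by simp
      then obtain l where "(x \<longlongrightarrow> l) (at_left t)"
        using assms(1) unfolding cadlag_def by blast
      then have "eventually (\<lambda>s. dist (x s) l < 1) (at_left t)"
        by (rule tendstoD) simp
      then obtain u where u: "u < t" "\<And>s. u < s \<Longrightarrow> s < t \<Longrightarrow> dist (x s) l < 1"
        unfolding eventually_at_left_field by auto
      have "norm (x s) \<le> norm l + 1" if "u < s" "s < t" for s
        using u(2)[OF that] norm_triangle_sub[of "x s" l] by (simp add: dist_norm)
      then show ?thesis
        using u(1) by (intro exI[of _ "t - u"]) auto
    qed
    obtain e where e: "e > 0" "\<And>s. t < s \<Longrightarrow> s < t + e \<Longrightarrow> norm (x s) \<le> norm (x t) + 1"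
      using right by auto
    obtain e' K where e': "e' > 0" "\<And>s. t - e' < s \<Longrightarrow> s < t \<Longrightarrow> 0 \<le> s \<Longrightarrow> norm (x s) \<le> K"
      using left by auto
    show ?case
    proof (intro exI[of _ "min e e'"] conjI allI impI)
      fix a b assume ab: "a \<le> t \<and> t \<le> b \<and> b - a < min e e'"
      have "norm (x s) \<le> max K (norm (x t) + 1)" if "s \<in> {a..b} \<inter> {0..}" for s
        using that ab e(2)[of s] e'(2)[of s] by (cases s t rule: linorder_cases) auto
      then show "P a b"
        unfolding P_def by (intro boundedI[where B="max K (norm (x t) + 1)"]) blast
    qed (use e(1) e'(1) in auto)
  qed
  moreover have "{0..T} \<inter> {0..} = {0..T}"
    by auto
  ultimately show ?thesis
    by (simp add: P_def)
qed

text \<open>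
  Sampling at the right endpoint of each cell is what suits a right-continuous path: the sampled time
  approaches \<open>t\<close> from above, so the step functions converge at every \<open>t \<in> (0, T]\<close>, jump times included, and
  dominated convergence applies. The weight \<open>w\<close> is integrated exactly over each cell, so that an antiderivative
  of it will appear in the sums.
\<close>

lemma right_endpoint_sums_tendsto_integral:
  fixes x :: "real \<Rightarrow> 'v::euclidean_space" and w :: "real \<Rightarrow> real"
  assumes "T > 0"
    and right_cont: "\<And>t. 0 \<le> t \<Longrightarrow> t < T \<Longrightarrow> (x \<longlongrightarrow> x t) (at_right t)"
    and bdd: "bounded (x ` {0..T})"
    and w: "continuous_on {0..T} w"
  shows "(\<lambda>m. \<Sum>i<Suc m. (LBINT t:{T * real i / real (Suc m)..T * real (Suc i) / real (Suc m)}. w t)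
            *\<^sub>R x (T * real (Suc i) / real (Suc m))) \<longlonglongrightarrow> (LBINT t:{0..T}. w t *\<^sub>R x t)"
proof -
  define u where "u m i = T * real i / real (Suc m)" for m i :: nat
  define I where "I m i = {u m i<..u m (Suc i)}" for m i
  define s where "s m t = (\<Sum>i<Suc m. (indicator (I m i) t * w t) *\<^sub>R x (u m (Suc i)))" for m t
  (* the cells are left-open, so the sums say nothing about time 0; it is a null set *)
  define F where "F t = (indicator {0<..T} t * w t) *\<^sub>R x t" for t
  obtain K where K: "\<And>t. 0 \<le> t \<Longrightarrow> t \<le> T \<Longrightarrow> norm (x t) \<le> K"
    using bdd unfolding bounded_iff by (metis atLeastAtMost_iff imageI)
  have "compact (w ` {0..T})"
    by (intro compact_continuous_image w) auto
  then obtain L where L: "\<And>t. 0 \<le> t \<Longrightarrow> t \<le> T \<Longrightarrow> \<bar>w t\<bar> \<le> L"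
    using compact_imp_bounded by (fastforce simp: bounded_iff)
  have L0: "0 \<le> L"
    using L[of 0] \<open>T > 0\<close> by linarith
  have u0: "u m 0 = 0" and uT: "u m (Suc m) = T" and u_mono: "i \<le> j \<Longrightarrow> u m i \<le> u m j"
    and u_step: "u m (Suc i) = u m i + T / real (Suc m)" for m i j
    using \<open>T > 0\<close> by (simp_all add: u_def divide_right_mono distrib_left add_divide_distrib del: of_nat_Suc)
       (simp add: distrib_left add_divide_distrib)
  have I_sub: "I m i \<subseteq> {0<..T}" if "i < Suc m" for m i
    using u_mono[of 0 i m] u_mono[of "Suc i" "Suc m" m] that by (auto simp: I_def u0 uT)
  have in_I: "\<exists>i<Suc m. t \<in> I m i" if "0 < t" "t \<le> T" for m t
  proof -
    define j where "j = (LEAST j. t \<le> u m j)"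
    have ex: "t \<le> u m (Suc m)"
      using that by (simp add: uT)
    have j: "t \<le> u m j" and j_le: "j \<le> Suc m"
      using ex unfolding j_def by (auto intro: LeastI Least_le)
    then have "j \<noteq> 0"
      using that u0[of m] by (intro notI) auto
    then obtain i where i: "j = Suc i"
      by (cases j) auto
    have "\<not> t \<le> u m i"
      using not_less_Least[of i "\<lambda>j. t \<le> u m j"] by (simp add: j_def[symmetric] i)
    then show ?thesis
      using j j_le i by (intro exI[of _ i]) (auto simp: I_def)
  qed
  have disj: "i = j" if "t \<in> I m i" "t \<in> I m j" for i j t m
    using that u_mono[of "Suc i" j m] u_mono[of "Suc j" i m]
    by (cases i j rule: linorder_cases) (auto simp: I_def)
  have s_in: "s m t = w t *\<^sub>R x (u m (Suc i))" if "i < Suc m" "t \<in> I m i" for m i t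
  proof -
    have "s m t = (\<Sum>j<Suc m. if j = i then w t *\<^sub>R x (u m (Suc i)) else 0)"
      unfolding s_def using that disj by (intro sum.cong) (auto simp: indicator_def)
    then show ?thesis
      using that by (simp add: sum.delta)
  qed
  have s_out: "s m t = 0" if "t \<notin> {0<..T}" for m t
    unfolding s_def using that I_sub by (intro sum.neutral) (fastforce simp: indicator_def)
  have w_meas: "(\<lambda>t. indicator A t * w t) \<in> borel_measurable borel" if "A \<subseteq> {0..T}" and [measurable]: "A \<in> sets borel" for A
  proof -
    have [measurable]: "(\<lambda>t. indicator {0..T} t *\<^sub>R w t) \<in> borel_measurable borel"
      by (intro borel_measurable_continuous_on_indicator w) simp
    have "(\<lambda>t. indicator A t * w t) = (\<lambda>t. indicator A t * (indicator {0..T} t *\<^sub>R w t))"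
    proof
      fix t
      show "indicator A t * w t = indicator A t * (indicator {0..T} t *\<^sub>R w t)"
        using subsetD[OF that(1), of t] by (cases "t \<in> A") auto
    qed
    then show ?thesis
      by (simp only:) measurable
  qed
  have [measurable]: "I m i \<in> sets borel" for m i
    by (simp add: I_def)
  have I_sub': "I m i \<subseteq> {0..T}" if "i < Suc m" for m i
    using I_sub[OF that] by auto
  have [measurable]: "s m \<in> borel_measurable borel" for m
    unfolding s_def using w_meas[OF I_sub'] by (intro borel_measurable_sum borel_measurable_scaleR) auto
  have conv: "(\<lambda>m. s m t) \<longlonglongrightarrow> F t" for t
  proof (cases "t \<in> {0<..T}")
    case False
    then show ?thesis
      by (auto simp: F_def s_out)
  next
    case True
    then have "\<forall>m. \<exists>i. i < Suc m \<and> t \<in> I m i"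
      using in_I[of t] by auto
    then obtain i where i: "\<And>m. i m < Suc m" "\<And>m. t \<in> I m (i m)"
      unfolding choice_iff by blast
    (* v m is the time at which the m-th step function samples the path when evaluated at t *)
    define v where "v m = u m (Suc (i m))" for m
    have v: "t \<le> v m" "v m \<le> t + T / real (Suc m)" "v m \<le> T" for m
      using i(2)[of m] u_mono[of "Suc (i m)" "Suc m" m] i(1)[of m] by (auto simp: I_def v_def u_step[of m "i m"] uT)
    have h: "(\<lambda>m. t + T * (1 / real (Suc m))) \<longlonglongrightarrow> t + T * 0"
      by (intro tendsto_add tendsto_mult tendsto_const LIMSEQ_Suc[OF lim_1_over_n])
    have v_lim: "v \<longlonglongrightarrow> t"
    proof (rule tendsto_sandwich[OF always_eventually always_eventually, where f="\<lambda>_. t"])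
      show "(\<lambda>m. t + T * (1 / real (Suc m))) \<longlonglongrightarrow> t"
        using h by (simp only: mult_zero_right add_0_right)
    qed (use v in auto)
    have xv: "(\<lambda>m. x (v m)) \<longlonglongrightarrow> x t"
    proof (cases "t = T")
      case True
      then have "v m = t" for m
        using v[of m] by simp
      then show ?thesis
        by simp
    next
      case False
      then have "(x \<longlongrightarrow> x t) (at_right t)"
        using \<open>t \<in> {0<..T}\<close> by (intro right_cont) auto
      then have "continuous (at t within {t..}) x"
        by (simp add: continuous_within at_within_Ici_at_right)
      then show ?thesis
        using v_lim v(1) by (simp add: continuous_within_sequentially o_def)
    qed
    have "s m t = w t *\<^sub>R x (v m)" for m
      unfolding v_def by (rule s_in) (use i in auto)
    moreover have "F t = w t *\<^sub>R x t"
      using True by (simp add: F_def)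
    ultimately show ?thesis
      using xv by (auto intro!: tendsto_intros)
  qed
  have F_meas: "F \<in> borel_measurable lborel"
    by (rule borel_measurable_LIMSEQ_metric[OF _ conv]) measurable
  have s_bound: "norm (s m t) \<le> indicator {0..T} t * (L * K)" for m t
  proof (cases "t \<in> {0<..T}")
    case True
    then obtain i where i: "i < Suc m" "t \<in> I m i"
      using in_I[of t m] by auto
    have "0 \<le> u m (Suc i)" "u m (Suc i) \<le> T"
      using u_mono[of 0 "Suc i" m] u_mono[of "Suc i" "Suc m" m] i by (auto simp: u0 uT)
    then show ?thesis
      using True L[of t] K[of "u m (Suc i)"] L0 by (auto simp: s_in[OF i] intro!: mult_mono)
  next
    case False
    have "0 \<le> K"
      using K[of 0] norm_ge_zero[of "x 0"] \<open>T > 0\<close> by linarith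
    then show ?thesis
      using False L0 by (simp add: s_out)
  qed
  have dom: "integrable lborel (\<lambda>t. indicator {0..T} t * (L * K))"
    by (intro integrable_mult_left integrable_real_indicator) (auto simp: emeasure_lborel_Icc_eq)
  have lim: "(\<lambda>m. integral\<^sup>L lborel (s m)) \<longlonglongrightarrow> integral\<^sup>L lborel F"
    by (rule integral_dominated_convergence[where s=s, OF F_meas _ dom]) (auto simp: conv s_bound)
  have F_eq: "(indicator {0..T} t * w t) *\<^sub>R x t = F t" if "t \<noteq> 0" for t
    using that by (auto simp: F_def indicator_def)
  have F_val: "integral\<^sup>L lborel F = (LBINT t:{0..T}. w t *\<^sub>R x t)"
    unfolding set_lebesgue_integral_def
    by (rule integral_discrete_difference[where X="{0}"]) (auto simp: F_eq)
  have "integral\<^sup>L lborel (s m) = (\<Sum>i<Suc m. (LBINT t:{u m i..u m (Suc i)}. w t) *\<^sub>R x (u m (Suc i)))" for m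
  proof -
    have int: "integrable lborel (\<lambda>t. indicator (I m i) t * w t)" if "i < Suc m" for i
    proof (rule Bochner_Integration.integrable_bound)
      show "integrable lborel (\<lambda>t. indicator {0..T} t * L)"
        by (intro integrable_mult_left integrable_real_indicator) (auto simp: emeasure_lborel_Icc_eq)
      show "(\<lambda>t. indicator (I m i) t * w t) \<in> borel_measurable lborel"
        using w_meas[OF I_sub'[OF that]] by simp
      have "norm (indicator (I m i) t * w t) \<le> norm (indicator {0..T} t * L)" for t
        using subsetD[OF I_sub'[OF that], of t] L[of t] L0 by (cases "t \<in> I m i") auto
      then show "AE t in lborel. norm (indicator (I m i) t * w t) \<le> norm (indicator {0..T} t * L)"
        by simp
    qed
    have "(\<integral>t. indicator (I m i) t * w t \<partial>lborel) = (LBINT t:{u m i..u m (Suc i)}. w t)" for i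
      unfolding set_lebesgue_integral_def
      by (rule integral_discrete_difference[where X="{u m i}"]) (auto simp: I_def indicator_def)
    then show ?thesis
      unfolding s_def using int by (subst Bochner_Integration.integral_sum) auto
  qed
  then show ?thesis
    using lim unfolding F_val u_def[symmetric] by simp
qed

text \<open>
  The sums over left and right endpoints differ by \<open>(f 0 - f T) T / (m + 1)\<close>, which tends to \<open>0\<close>.
\<close>

lemma riemann_sums_tendsto_integral:
  fixes f :: "real \<Rightarrow> 'v::euclidean_space"
  assumes "T > 0" and f: "continuous_on {0..T} f"
  shows "(\<lambda>m. (T / real (Suc m)) *\<^sub>R (\<Sum>i<Suc m. f (T * real i / real (Suc m))))
    \<longlonglongrightarrow> (LBINT t:{0..T}. f t)"
proof -
  let ?u = "\<lambda>m i. T * real i / real (Suc m)"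
  have bdd: "bounded (f ` {0..T})"
    by (intro compact_imp_bounded compact_continuous_image f) auto
  have rc: "(f \<longlongrightarrow> f t) (at_right t)" if "0 \<le> t" "t < T" for t
  proof -
    have "continuous_on {t..T} f"
      by (rule continuous_on_subset[OF f]) (use that in auto)
    then show ?thesis
      using that by (simp add: continuous_on_Icc_at_rightD)
  qed
  have step: "(LBINT t:{?u m i..?u m (Suc i)}. (1::real)) = T / real (Suc m)" for m i
    using \<open>T > 0\<close> by (simp add: set_lebesgue_integral_def measure_lborel_Icc divide_right_mono diff_divide_distrib[symmetric] algebra_simps)
  have R: "(\<lambda>m. (T / real (Suc m)) *\<^sub>R (\<Sum>i<Suc m. f (?u m (Suc i)))) \<longlonglongrightarrow> (LBINT t:{0..T}. f t)"
    using right_endpoint_sums_tendsto_integral[OF \<open>T > 0\<close> rc bdd continuous_on_const[of _ 1]]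
    by (simp add: step scaleR_sum_right del: sum.lessThan_Suc of_nat_Suc)
  have D: "(\<lambda>m. (T * (1 / real (Suc m))) *\<^sub>R (f 0 - f T)) \<longlonglongrightarrow> (T * 0) *\<^sub>R (f 0 - f T)"
    by (intro tendsto_scaleR tendsto_mult tendsto_const LIMSEQ_Suc[OF lim_1_over_n])
  have "(\<Sum>i<Suc m. f (?u m i)) = (\<Sum>i<Suc m. f (?u m (Suc i))) + (f 0 - f T)" for m
    using sum_lessThan_telescope[of "\<lambda>i. f (?u m i)" "Suc m"] by (simp add: sum_subtractf algebra_simps del: sum.lessThan_Suc of_nat_Suc)
  then show ?thesis
    using tendsto_add[OF R D] by (simp add: scaleR_add_right del: sum.lessThan_Suc of_nat_Suc)
qed

section \<open>Characteristic functions determine laws on Euclidean spaces\<close>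

text \<open>
  Levy's uniqueness theorem for probability measures extends to finite measures by normalisation, the
  total mass being the value of the transform at \<open>0\<close>.
\<close>

lemma finite_measure_char_unique:
  fixes M1 M2 :: "real measure"
  assumes "finite_measure M1" "finite_measure M2"
    and [measurable_cong]: "sets M1 = sets borel" "sets M2 = sets borel"
    and eq: "\<And>t. (\<integral>x. iexp (t * x) \<partial>M1) = (\<integral>x. iexp (t * x) \<partial>M2)"
  shows "M1 = M2"
proof -
  interpret M1: finite_measure M1 by fact
  interpret M2: finite_measure M2 by fact
  have sp: "space M1 = UNIV" "space M2 = UNIV"
    using assms(3,4) by (simp_all add: sets_eq_imp_space_eq)
  define c where "c = measure M1 UNIV"
  have c2: "measure M2 UNIV = c"
    using eq[of 0] by (simp add: c_def sp)
  show ?thesis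
  proof (cases "c = 0")
    case True
    have "emeasure M A = 0" if "finite_measure M" "space M = UNIV" "measure M UNIV = 0" for M :: "real measure" and A
    proof -
      interpret finite_measure M by fact
      show ?thesis
        using that(3) measure_le_0_iff[of M A] bounded_measure[of A] that(2) by (simp add: emeasure_eq_measure)
    qed
    then show ?thesis
      using True c2 assms(1,2) sp assms(3,4) by (intro measure_eqI) (auto simp: c_def)
  next
    case False
    then have c0: "c > 0"
      by (simp add: c_def zero_less_measure_iff measure_le_0_iff less_le)
    have normal: "real_distribution (density M (\<lambda>_. ennreal (1 / c)))"
      and char_normal: "char (density M (\<lambda>_. ennreal (1 / c))) t = (1 / c) *\<^sub>R (\<integral>x. iexp (t * x) \<partial>M)"
      if "finite_measure M" "measure M UNIV = c" and [measurable_cong]: "sets M = sets borel" for M :: "real measure" and t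
    proof -
      interpret finite_measure M by fact
      have sp: "space M = UNIV"
        using that(3) by (simp add: sets_eq_imp_space_eq)
      have "emeasure (density M (\<lambda>_. ennreal (1 / c))) UNIV = ennreal (1 / c) * emeasure M UNIV"
        using sp by (subst emeasure_density) (auto simp: nn_integral_cmult)
      also have "\<dots> = 1"
        using c0 that(2) by (simp add: emeasure_eq_measure ennreal_mult[symmetric] ennreal_1[symmetric] del: ennreal_1)
      finally show "real_distribution (density M (\<lambda>_. ennreal (1 / c)))"
        using that(3) sp by (auto simp: real_distribution_def real_distribution_axioms_def intro!: prob_spaceI)
      show "char (density M (\<lambda>_. ennreal (1 / c))) t = (1 / c) *\<^sub>R (\<integral>x. iexp (t * x) \<partial>M)"
        unfolding char_def using c0 by (subst integral_density) auto
    qed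
    have "density M1 (\<lambda>_. ennreal (1 / c)) = density M2 (\<lambda>_. ennreal (1 / c))"
      by (intro Levy_uniqueness normal ext) (simp_all add: assms char_normal c_def[symmetric] c2 eq[simplified])
    moreover have "density (density M (\<lambda>_. ennreal (1 / c))) (\<lambda>_. ennreal c) = M" 
      if [measurable_cong]: "sets M = sets borel" for M :: "real measure"
      using c0 by (subst density_density_eq) (auto simp: ennreal_mult[symmetric] density_1)
    ultimately show ?thesis
      using assms(3,4) by metis
  qed
qed

text \<open>
  The step from one to several dimensions. If \<open>h \<ge> 0\<close> is a trigonometric polynomial, the transform of
  \<open>h M\<close> is a combination of values of the transform of \<open>M\<close>; so the images of \<open>h M\<^sub>1\<close> and \<open>h M\<^sub>2\<close> under
  \<open>y \<mapsto> y \<bullet> b\<close> are equal by the one-dimensional uniqueness theorem. Taking \<open>h\<close> to be \<open>1\<close>, \<open>1 + cos (w \<bullet> y)\<close>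
  and \<open>1 + sin (w \<bullet> y)\<close> shows that restricting both measures to the slab \<open>y \<bullet> b \<in> B\<close> keeps their transforms
  equal.
\<close>

lemma char_eq_density_slab:
  fixes M1 M2 :: "'v::euclidean_space measure"
  assumes "finite_measure M1" "finite_measure M2"
    and [measurable_cong]: "sets M1 = sets borel" "sets M2 = sets borel"
    and eq: "\<And>w. (\<integral>y. iexp (w \<bullet> y) \<partial>M1) = (\<integral>y. iexp (w \<bullet> y) \<partial>M2)"
    and [measurable]: "B \<in> sets borel"
  shows "(\<integral>y. iexp (w \<bullet> y) \<partial>density M1 (indicator {y. y \<bullet> b \<in> B})) =
    (\<integral>y. iexp (w \<bullet> y) \<partial>density M2 (indicator {y. y \<bullet> b \<in> B}))"
proof -
  let ?I = "\<lambda>y. indicator B (y \<bullet> b) :: real"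
  have int: "integrable M f" if "finite_measure M" and [measurable_cong]: "sets M = sets borel"
    and [measurable]: "f \<in> borel_measurable borel" and "\<And>y. norm (f y) \<le> 2"
    for M :: "'v measure" and f :: "'v \<Rightarrow> 'z::{banach, second_countable_topology}"
  proof -
    interpret finite_measure M by fact
    show ?thesis
      using that(4) by (intro integrable_const_bound[of _ 2]) auto
  qed
  have slab: "(\<integral>y. h y * ?I y \<partial>M1) = (\<integral>y. h y * ?I y \<partial>M2)"
    if [measurable]: "h \<in> borel_measurable borel" and h: "\<And>y. 0 \<le> h y" "\<And>y. h y \<le> 2"
      and h_eq: "\<And>u. (\<integral>y. h y *\<^sub>R iexp (u \<bullet> y) \<partial>M1) = (\<integral>y. h y *\<^sub>R iexp (u \<bullet> y) \<partial>M2)" for h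
  proof -
    define D where "D M = distr (density M (\<lambda>y. ennreal (h y))) borel (\<lambda>y. y \<bullet> b)" for M :: "'v measure"
    have D_int: "(\<integral>x. f x \<partial>D M) = (\<integral>y. h y *\<^sub>R f (y \<bullet> b) \<partial>M)"
      if [measurable_cong]: "sets M = sets borel" and [measurable]: "f \<in> borel_measurable borel"
      for M and f :: "real \<Rightarrow> 'z::{banach, second_countable_topology}"
      unfolding D_def using h(1) by (simp add: integral_distr integral_density)
    have D_fin: "finite_measure (D M)" if "finite_measure M" and [measurable_cong]: "sets M = sets borel" for M
    proof -
      have "integrable M h"
        using h by (intro int that) auto
      then have "(\<integral>\<^sup>+ y. ennreal (h y) \<partial>M) < \<infinity>"
        using h(1) by (simp add: integrable_iff_bounded)
      moreover have "space M = UNIV"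
        using that(2) by (simp add: sets_eq_imp_space_eq)
      ultimately show ?thesis
        unfolding D_def by (intro finite_measure.finite_measure_distr finite_measureI) (auto simp: emeasure_density)
    qed
    have "D M1 = D M2"
    proof (rule finite_measure_char_unique)
      fix t
      show "(\<integral>x. iexp (t * x) \<partial>D M1) = (\<integral>x. iexp (t * x) \<partial>D M2)"
        using h_eq[of "t *\<^sub>R b"] by (simp add: D_int assms inner_commute)
    qed (simp_all add: D_fin assms, simp_all add: D_def)
    then have "(\<integral>x. (indicator B x :: real) \<partial>D M1) = (\<integral>x. indicator B x \<partial>D M2)"
      by simp
    then show ?thesis
      by (simp only: D_int[OF assms(3) borel_measurable_indicator[OF assms(6)]]
        D_int[OF assms(4) borel_measurable_indicator[OF assms(6)]] real_scaleR_def)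
  qed
  have cos: "(1 + cos v) *\<^sub>R iexp u = iexp u + (1/2) * iexp (u + v) + (1/2) * iexp (u - v)" for u v
    by (simp add: complex_eq_iff Re_exp Im_exp cos_add cos_diff sin_add sin_diff field_simps)
  have sin: "(1 + sin v) *\<^sub>R iexp u = iexp u - (\<i>/2) * iexp (u + v) + (\<i>/2) * iexp (u - v)" for u v
    by (simp add: complex_eq_iff Re_exp Im_exp cos_add cos_diff sin_add sin_diff field_simps)
  have s0: "(\<integral>y. ?I y \<partial>M1) = (\<integral>y. ?I y \<partial>M2)"
    using slab[of "\<lambda>_. 1"] eq by simp
  have s1: "(\<integral>y. (1 + cos (w \<bullet> y)) * ?I y \<partial>M1) = (\<integral>y. (1 + cos (w \<bullet> y)) * ?I y \<partial>M2)"
  proof (rule slab)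
    fix u
    have "(\<integral>y. (1 + cos (w \<bullet> y)) *\<^sub>R iexp (u \<bullet> y) \<partial>M) =
      (\<integral>y. iexp (u \<bullet> y) \<partial>M) + (1/2) * (\<integral>y. iexp ((u + w) \<bullet> y) \<partial>M) + (1/2) * (\<integral>y. iexp ((u - w) \<bullet> y) \<partial>M)"
      if "finite_measure M" "sets M = sets borel" for M
      unfolding cos inner_add_left inner_diff_left
      by (simp add: int[OF that])
    then show "(\<integral>y. (1 + cos (w \<bullet> y)) *\<^sub>R iexp (u \<bullet> y) \<partial>M1) = (\<integral>y. (1 + cos (w \<bullet> y)) *\<^sub>R iexp (u \<bullet> y) \<partial>M2)"
      using assms eq by simp
    show "0 \<le> 1 + cos (w \<bullet> u)" "1 + cos (w \<bullet> u) \<le> 2"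
      using cos_ge_minus_one[of "w \<bullet> u"] cos_le_one[of "w \<bullet> u"] by linarith+
  qed measurable
  have s2: "(\<integral>y. (1 + sin (w \<bullet> y)) * ?I y \<partial>M1) = (\<integral>y. (1 + sin (w \<bullet> y)) * ?I y \<partial>M2)"
  proof (rule slab)
    fix u
    have "(\<integral>y. (1 + sin (w \<bullet> y)) *\<^sub>R iexp (u \<bullet> y) \<partial>M) =
      (\<integral>y. iexp (u \<bullet> y) \<partial>M) - (\<i>/2) * (\<integral>y. iexp ((u + w) \<bullet> y) \<partial>M) + (\<i>/2) * (\<integral>y. iexp ((u - w) \<bullet> y) \<partial>M)"
      if "finite_measure M" "sets M = sets borel" for M
      unfolding sin inner_add_left inner_diff_left
      by (simp add: int[OF that])
    then show "(\<integral>y. (1 + sin (w \<bullet> y)) *\<^sub>R iexp (u \<bullet> y) \<partial>M1) = (\<integral>y. (1 + sin (w \<bullet> y)) *\<^sub>R iexp (u \<bullet> y) \<partial>M2)"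
      using assms eq by simp
    show "0 \<le> 1 + sin (w \<bullet> u)" "1 + sin (w \<bullet> u) \<le> 2"
      using sin_ge_minus_one[of "w \<bullet> u"] sin_le_one[of "w \<bullet> u"] by linarith+
  qed measurable
  (* recover cos and sin, hence the complex exponential, from the three nonnegative weights *)
  have split: "(\<integral>y. iexp (w \<bullet> y) \<partial>density M (indicator {y. y \<bullet> b \<in> B})) =
      complex_of_real ((\<integral>y. (1 + cos (w \<bullet> y)) * ?I y \<partial>M) - (\<integral>y. ?I y \<partial>M)) +
      \<i> * complex_of_real ((\<integral>y. (1 + sin (w \<bullet> y)) * ?I y \<partial>M) - (\<integral>y. ?I y \<partial>M))"
    if "finite_measure M" and [measurable_cong]: "sets M = sets borel" for M
  proof -
    have i: "integrable M ?I" and c: "integrable M (\<lambda>y. cos (w \<bullet> y) * ?I y)"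
      and s: "integrable M (\<lambda>y. sin (w \<bullet> y) * ?I y)"
      by (intro int[OF that]; auto simp: indicator_def
          intro: order_trans[OF abs_cos_le_one] order_trans[OF abs_sin_le_one])+
    have "(\<integral>y. iexp (w \<bullet> y) \<partial>density M (indicator {y. y \<bullet> b \<in> B})) =
        (\<integral>y. ?I y *\<^sub>R iexp (w \<bullet> y) \<partial>M)"
      by (subst integral_density[symmetric])
         (auto simp: indicator_def intro!: arg_cong2[where f="integral\<^sup>L"] arg_cong2[where f=density])
    also have "\<dots> = (\<integral>y. complex_of_real (cos (w \<bullet> y) * ?I y) + \<i> * complex_of_real (sin (w \<bullet> y) * ?I y) \<partial>M)"
      by (intro Bochner_Integration.integral_cong refl) (simp add: complex_eq_iff Re_exp Im_exp)
    also have "\<dots> = complex_of_real (\<integral>y. cos (w \<bullet> y) * ?I y \<partial>M) + \<i> * complex_of_real (\<integral>y. sin (w \<bullet> y) * ?I y \<partial>M)"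
      by (simp only: Bochner_Integration.integral_add[OF integrable_of_real[OF c] integrable_mult_right[OF integrable_of_real[OF s]]]
          integral_mult_right_zero integral_complex_of_real)
    also have "(\<integral>y. cos (w \<bullet> y) * ?I y \<partial>M) = (\<integral>y. (1 + cos (w \<bullet> y)) * ?I y \<partial>M) - (\<integral>y. ?I y \<partial>M)"
      by (simp only: distrib_right mult_1 Bochner_Integration.integral_add[OF i c] add_diff_cancel_left')
    also have "(\<integral>y. sin (w \<bullet> y) * ?I y \<partial>M) = (\<integral>y. (1 + sin (w \<bullet> y)) * ?I y \<partial>M) - (\<integral>y. ?I y \<partial>M)"
      by (simp only: distrib_right mult_1 Bochner_Integration.integral_add[OF i s] add_diff_cancel_left')
    finally show ?thesis .
  qed
  show ?thesis
    using s0 s1 s2 by (simp only: split[OF assms(1,3)] split[OF assms(2,4)])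
qed

text \<open>
  A box is the intersection of one slab for each coordinate. Restricting to these slabs one after
  another keeps the transforms equal, and at \<open>w = 0\<close> they give the masses of the box.
\<close>

lemma char_unique_euclidean:
  fixes M1 M2 :: "'v::euclidean_space measure"
  assumes "finite_measure M1" "finite_measure M2"
    and [measurable_cong]: "sets M1 = sets borel" "sets M2 = sets borel"
    and eq: "\<And>w. (\<integral>y. iexp (w \<bullet> y) \<partial>M1) = (\<integral>y. iexp (w \<bullet> y) \<partial>M2)"
  shows "M1 = M2"
proof -
  interpret M1: finite_measure M1 by fact
  interpret M2: finite_measure M2 by fact
  have box: "emeasure M1 (box l u) = emeasure M2 (box l u)" for l u :: 'v
  proof -
    define C where "C S = {y. \<forall>b\<in>S. y \<bullet> b \<in> {l \<bullet> b<..<u \<bullet> b}}" for S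
    have C_meas: "finite S \<Longrightarrow> C S \<in> sets borel" for S
      unfolding C_def by measurable
    have C_UNIV: "(indicator UNIV :: 'v \<Rightarrow> ennreal) = (\<lambda>_. 1)"
      by auto
    have dens_fin: "finite_measure (density M (indicator A))"
      if "finite_measure M" "A \<in> sets M" for A and M :: "'v measure"
    proof -
      interpret finite_measure M by fact
      show ?thesis
        using that(2) by (intro finite_measureI) (simp add: emeasure_density emeasure_finite flip: indicator_inter_arith)
    qed
    have "(\<integral>y. iexp (w \<bullet> y) \<partial>density M1 (indicator (C S))) = (\<integral>y. iexp (w \<bullet> y) \<partial>density M2 (indicator (C S)))"
      if "finite S" for S w
      using that
    proof (induction S arbitrary: w)
      case empty
      then show ?case
        using eq by (simp add: C_def density_1 C_UNIV)
    next
      case (insert b S)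
      have split: "density M (indicator (C (insert b S))) =
        density (density M (indicator (C S))) (indicator {y. y \<bullet> b \<in> {l \<bullet> b<..<u \<bullet> b}})"
        if [measurable_cong]: "sets M = sets borel" for M
        using C_meas[OF insert(1)]
        by (subst density_density_eq) (auto simp: C_def indicator_def intro!: arg_cong2[where f=density])
      have "C S \<in> sets M1" "C S \<in> sets M2"
        using C_meas[OF insert(1)] assms(3,4) by auto
      then show ?case
        unfolding split[OF assms(3)] split[OF assms(4)]
        by (intro char_eq_density_slab dens_fin insert.IH) (auto simp: assms)
    qed
    from this[of Basis 0] have "measure M1 (C Basis) = measure M2 (C Basis)"
      using C_meas[of Basis] assms(3,4)
      by (simp add: measure_def emeasure_density sets_eq_imp_space_eq[OF assms(3)] sets_eq_imp_space_eq[OF assms(4)])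
    moreover have "C Basis = box l u"
      by (auto simp: C_def box_def)
    ultimately show ?thesis
      by (simp add: M1.emeasure_eq_measure M2.emeasure_eq_measure)
  qed
  show ?thesis
  proof (rule measure_eqI_generator_eq)
    show "Int_stable (range (\<lambda>(a, b). box a b :: 'v set))"
      by (auto simp: Int_stable_def box_Int_box)
    show "range (\<lambda>i::nat. box (- (real i *\<^sub>R One)) (real i *\<^sub>R One)) \<subseteq> range (\<lambda>(a, b). box a b :: 'v set)"
      by auto
    show "(\<Union>i::nat. box (- (real i *\<^sub>R One)) (real i *\<^sub>R One :: 'v)) = UNIV"
      by (rule UN_box_eq_UNIV)
    show "sets M1 = sigma_sets UNIV (range (\<lambda>(a, b). box a b))" "sets M2 = sigma_sets UNIV (range (\<lambda>(a, b). box a b))"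
      using assms(3,4) by (simp_all add: borel_eq_box)
  qed (auto simp: box)
qed

section \<open>The coefficients as limits of weighted sums of increments\<close>

lemma kl_kernel_scaleR: "kl_kernel idx T (x, t) = x *\<^sub>R kl_kernel idx T (1, t)"
  by (simp add: kl_kernel_def vec_eq_iff)

lemma kl_kernel_terminal: "T > 0 \<Longrightarrow> kl_kernel idx T (x, T) = 0"
proof -
  assume "T > 0"
  have "cos (pi * (real k - 1 / 2)) = 0" for k :: nat
  proof -
    have "cos (pi * (real k - 1 / 2)) = cos (real k * pi - pi / 2)"
      by (simp add: algebra_simps)
    also have "\<dots> = 0"
      by (simp add: cos_diff)
    finally show ?thesis .
  qed
  then show ?thesis
    using \<open>T > 0\<close> by (simp add: kl_kernel_def vec_eq_iff)
qed

lemma continuous_on_kl_kernel [continuous_intros]: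
  "continuous_on S (\<lambda>t. kl_kernel idx T (x, t))"
  unfolding kl_kernel_def prod.case divide_inverse by (intro continuous_intros)

lemma norm_kl_kernel_le:
  obtains C where "C \<ge> 1" "\<And>x t. 0 \<le> t \<Longrightarrow> t \<le> T \<Longrightarrow> norm (kl_kernel idx T (x, t)) \<le> C * \<bar>x\<bar>"
proof -
  have "compact ((\<lambda>t. kl_kernel idx T (1, t)) ` {0..T})"
    by (intro compact_continuous_image continuous_intros) auto
  then have "bounded ((\<lambda>t. kl_kernel idx T (1, t)) ` {0..T})"
    by (rule compact_imp_bounded)
  then obtain C where "\<forall>y\<in>(\<lambda>t. kl_kernel idx T (1, t)) ` {0..T}. norm y \<le> C"
    unfolding bounded_iff by blast
  then have C: "norm (kl_kernel idx T (1, t)) \<le> C" if "0 \<le> t" "t \<le> T" for t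
    using that by auto
  show thesis
  proof
    fix x t assume "0 \<le> t" "t \<le> T"
    then have "norm (kl_kernel idx T (1, t)) \<le> max 1 C"
      using C by (simp add: max.coboundedI2)
    then show "norm (kl_kernel idx T (x, t)) \<le> max 1 C * \<bar>x\<bar>"
      unfolding kl_kernel_scaleR[of idx T x t] by (simp add: mult.commute mult_left_mono)
  qed simp
qed

text \<open>
  The component of \<open>kl_kernel\<close> with \<open>x = 1\<close> is an antiderivative of minus the eigenfunction.
\<close>

lemma integral_kl_eigenfunction:
  assumes "T > 0" "a \<le> b"
  shows "(LBINT t:{a..b}. kl_eigenfunction T (idx j) t) =
    kl_kernel idx T (1, a) $ j - kl_kernel idx T (1, b) $ j"
proof -
  let ?c = "real (idx j) - 1 / 2"
  let ?G = "\<lambda>t. - (sqrt (2 * T) / pi * (cos (pi / T * ?c * t) / ?c))"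
  have c: "?c \<noteq> 0"
  proof
    assume "?c = 0"
    then have "real (2 * idx j) = real 1"
      by simp
    then show False
      by (simp only: of_nat_eq_iff) presburger
  qed
  (* differentiating the cosine brings out the factor pi / T * ?c, which normalises the amplitude *)
  have "sqrt (2 * T) / T = sqrt (2 / T)"
    using \<open>T > 0\<close> by (simp add: real_sqrt_divide real_sqrt_mult field_simps)
  then have coeff: "sqrt (2 / T) = sqrt (2 * T) / pi * (pi / T * ?c / ?c)"
    using c by simp
  have "(?G has_vector_derivative kl_eigenfunction T (idx j) t) (at t within {a..b})" for t
    unfolding has_real_derivative_iff_has_vector_derivative[symmetric] kl_eigenfunction_def coeff
    using c \<open>T > 0\<close> by (auto intro!: derivative_eq_intros)
  moreover have "continuous_on {a..b} (kl_eigenfunction T (idx j))"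
    unfolding kl_eigenfunction_def by (intro continuous_intros)
  ultimately have "has_bochner_integral lborel (\<lambda>t. indicator {a..b} t *\<^sub>R kl_eigenfunction T (idx j) t) (?G b - ?G a)"
    by (intro has_bochner_integral_FTC_Icc \<open>a \<le> b\<close>) auto
  then show ?thesis
    unfolding set_lebesgue_integral_def by (simp add: has_bochner_integral_iff kl_kernel_def)
qed

lemma summation_by_parts:
  fixes x g :: "nat \<Rightarrow> 'r::comm_ring"
  assumes "x 0 = 0" "g n = 0"
  shows "(\<Sum>i<n. (g i - g (Suc i)) * x (Suc i)) = (\<Sum>i<n. (x (Suc i) - x i) * g i)"
proof -
  have "(g i - g (Suc i)) * x (Suc i) = (x (Suc i) - x i) * g i + (x i * g i - x (Suc i) * g (Suc i))" for i
    by (simp add: algebra_simps)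
  then have "(\<Sum>i<n. (g i - g (Suc i)) * x (Suc i)) =
      (\<Sum>i<n. (x (Suc i) - x i) * g i) + (\<Sum>i<n. x i * g i - x (Suc i) * g (Suc i))"
    by (simp add: sum.distrib)
  then show ?thesis
    using assms sum_lessThan_telescope'[of "\<lambda>i. x i * g i" n] by simp
qed

text \<open>
  The approximation of the stochastic integral of \<open>g\<close> against \<open>X\<close> over \<open>[0, T]\<close> that freezes \<open>g\<close> at the
  left endpoints of \<open>m + 1\<close> cells of equal length.
\<close>

definition levy_sum :: "(real \<Rightarrow> 'v::real_vector) \<Rightarrow> (real \<Rightarrow> 'a \<Rightarrow> real) \<Rightarrow> real \<Rightarrow> nat \<Rightarrow> 'a \<Rightarrow> 'v" where
  "levy_sum g X T m \<omega> = (\<Sum>i<Suc m.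
     (X (T * real (Suc i) / real (Suc m)) \<omega> - X (T * real i / real (Suc m)) \<omega>) *\<^sub>R g (T * real i / real (Suc m)))"

text \<open>
  Integration by parts on the grid. The boundary terms vanish because the path starts at \<open>0\<close> and the
  kernel ends at \<open>0\<close>.
\<close>

lemma levy_sum_tendsto_kl_vector:
  fixes idx :: "'d::finite \<Rightarrow> nat"
  assumes "T > 0" and "cadlag (\<lambda>t. X t \<omega>)" and "X 0 \<omega> = 0"
  shows "(\<lambda>m. levy_sum (\<lambda>t. kl_kernel idx T (1, t)) X T m \<omega>) \<longlonglongrightarrow> kl_vector idx X T \<omega>"
proof (rule vec_tendstoI)
  fix j
  let ?u = "\<lambda>m i. T * real i / real (Suc m)"
  let ?g = "\<lambda>t. kl_kernel idx T (1, t) $ j"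
  have rc: "((\<lambda>t. X t \<omega>) \<longlongrightarrow> X t \<omega>) (at_right t)" if "0 \<le> t" for t
    using assms(2) that by (simp add: cadlag_def)
  have "continuous_on {0..T} (kl_eigenfunction T (idx j))"
    unfolding kl_eigenfunction_def by (intro continuous_intros)
  note lim = right_endpoint_sums_tendsto_integral[OF \<open>T > 0\<close> rc cadlag_bounded[OF assms(2)] this]
  (* the weights of the Riemann sum are the differences of the kernel over the cells *)
  have "levy_sum (\<lambda>t. kl_kernel idx T (1, t)) X T m \<omega> $ j =
    (\<Sum>i<Suc m. (LBINT t:{?u m i..?u m (Suc i)}. kl_eigenfunction T (idx j) t) *\<^sub>R X (?u m (Suc i)) \<omega>)" for m
  proof -
    have "?u m i \<le> ?u m (Suc i)" for i
      using \<open>T > 0\<close> by (simp add: divide_right_mono)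
    then have "(\<Sum>i<Suc m. (LBINT t:{?u m i..?u m (Suc i)}. kl_eigenfunction T (idx j) t) *\<^sub>R X (?u m (Suc i)) \<omega>)
      = (\<Sum>i<Suc m. (?g (?u m i) - ?g (?u m (Suc i))) * X (?u m (Suc i)) \<omega>)"
      using \<open>T > 0\<close> by (simp add: integral_kl_eigenfunction[of T _ _ idx] del: sum.lessThan_Suc of_nat_Suc)
    also have "\<dots> = (\<Sum>i<Suc m. (X (?u m (Suc i)) \<omega> - X (?u m i) \<omega>) * ?g (?u m i))"
      using assms(3) \<open>T > 0\<close> by (intro summation_by_parts) (simp_all add: kl_kernel_terminal del: of_nat_Suc)
    finally show ?thesis
      by (simp add: levy_sum_def del: sum.lessThan_Suc of_nat_Suc)
  qed
  then show "(\<lambda>m. levy_sum (\<lambda>t. kl_kernel idx T (1, t)) X T m \<omega> $ j) \<longlonglongrightarrow> kl_vector idx X T \<omega> $ j"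
    using lim \<open>T > 0\<close> by (simp add: kl_vector_def kl_coeff_def mult.commute del: sum.lessThan_Suc of_nat_Suc)
qed

section \<open>The characteristic function of the coefficients\<close>

lemma measurable_levy_sum:
  fixes g :: "real \<Rightarrow> 'v::euclidean_space"
  assumes "levy_process M X" "T > 0"
  shows "levy_sum g X T m \<in> borel_measurable M"
proof -
  have "X t \<in> borel_measurable M" if "t \<ge> 0" for t
    using assms(1) that by (simp add: levy_process_def)
  then show ?thesis
    unfolding levy_sum_def using \<open>T > 0\<close>
    by (intro borel_measurable_sum borel_measurable_scaleR borel_measurable_diff borel_measurable_const) auto
qed

lemma levy_grid_increments:
  fixes X :: "real \<Rightarrow> 'a \<Rightarrow> real"
  fixes m :: nat
  assumes "levy_process M X" "T > 0"
  defines "D \<equiv> \<lambda>i \<omega>. X (T * real (Suc i) / real (Suc m)) \<omega> - X (T * real i / real (Suc m)) \<omega>"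
  shows "prob_space.indep_vars M (\<lambda>_. borel) D {..<Suc m}"
    and "distr M borel (D i) = distr M borel (X (T / real (Suc m)))"
    and "D i \<in> borel_measurable M"
proof -
  let ?t = "\<lambda>i. T * real i / real (Suc m)"
  have grid: "?t 0 \<ge> 0 \<and> (\<forall>i<Suc m. ?t i < ?t (Suc i))"
    using \<open>T > 0\<close> by (simp add: divide_strict_right_mono)
  have "\<forall>(n::nat) (t::nat \<Rightarrow> real). 0 \<le> t 0 \<and> (\<forall>i<n. t i < t (Suc i)) \<longrightarrow>
      prob_space.indep_vars M (\<lambda>_. borel) (\<lambda>i \<omega>. X (t (Suc i)) \<omega> - X (t i) \<omega>) {..<n}"
    using assms(1) unfolding levy_process_def by (elim conjE)
  from this[THEN spec, THEN spec, THEN mp, OF grid]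
  show "prob_space.indep_vars M (\<lambda>_. borel) D {..<Suc m}"
    unfolding D_def .
  have step: "?t (Suc i) = ?t i + T / real (Suc m)"
    by (simp add: distrib_left add_divide_distrib)
  have nonneg: "?t i \<ge> 0" "T / real (Suc m) \<ge> 0"
    using \<open>T > 0\<close> by auto
  have "\<forall>s\<ge>0. \<forall>h\<ge>0. distr M borel (\<lambda>\<omega>. X (s + h) \<omega> - X s \<omega>) = distr M borel (X h)"
    using assms(1) unfolding levy_process_def by (elim conjE)
  from this[rule_format, OF nonneg] show "distr M borel (D i) = distr M borel (X (T / real (Suc m)))"
    unfolding D_def step .
  show "D i \<in> borel_measurable M"
    unfolding D_def using assms(1) \<open>T > 0\<close> by (intro borel_measurable_diff) (auto simp: levy_process_def)
qed

text \<open>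
  Increments over disjoint cells are independent, and each has the law of \<open>X\<close> at time \<open>T / (m + 1)\<close>.
\<close>

lemma char_levy_sum:
  fixes X :: "real \<Rightarrow> 'a \<Rightarrow> real" and g :: "real \<Rightarrow> 'v::euclidean_space"
  assumes "levy_process M X" "T > 0"
    and char: "\<And>t z. t \<ge> 0 \<Longrightarrow> (\<integral>\<omega>. iexp (z * X t \<omega>) \<partial>M) = exp (- (complex_of_real t * \<psi> z))"
  shows "(\<integral>\<omega>. iexp (z \<bullet> levy_sum g X T m \<omega>) \<partial>M) =
    exp (- ((T / real (Suc m)) *\<^sub>R (\<Sum>i<Suc m. \<psi> (z \<bullet> g (T * real i / real (Suc m))))))"
proof -
  interpret prob_space M
    using assms(1) by (simp add: levy_process_def)
  define D where "D i \<omega> = X (T * real (Suc i) / real (Suc m)) \<omega> - X (T * real i / real (Suc m)) \<omega>" for i \<omega>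
  define c where "c i = z \<bullet> g (T * real i / real (Suc m))" for i
  note D = levy_grid_increments[OF assms(1,2), where m=m, folded D_def]
  have [measurable]: "D i \<in> borel_measurable M" for i
    using D(3)[of i] by (simp add: D_def[abs_def])
  have "T / real (Suc m) \<ge> 0"
    using \<open>T > 0\<close> by simp
  then have Xm: "X (T / real (Suc m)) \<in> borel_measurable M"
    using assms(1) unfolding levy_process_def by blast
  have ind: "indep_vars (\<lambda>_. borel) (\<lambda>i \<omega>. iexp (c i * D i \<omega>)) {..<Suc m}"
    using D(1) by (rule indep_vars_compose2[where Y="\<lambda>i x. iexp (c i * x)"]) measurable
  have one: "(\<integral>\<omega>. iexp (c i * D i \<omega>) \<partial>M) = exp (- (complex_of_real (T / real (Suc m)) * \<psi> (c i)))" for i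
  proof -
    have "(\<integral>\<omega>. iexp (c i * D i \<omega>) \<partial>M) = (\<integral>x. iexp (c i * x) \<partial>distr M borel (D i))"
      by (subst integral_distr) auto
    also have "distr M borel (D i) = distr M borel (X (T / real (Suc m)))"
      using D(2)[of i] by (simp add: D_def[abs_def])
    also have "(\<integral>x. iexp (c i * x) \<partial>\<dots>) = (\<integral>\<omega>. iexp (c i * X (T / real (Suc m)) \<omega>) \<partial>M)"
      by (rule integral_distr[OF Xm]) measurable
    finally show ?thesis
      using char[of "T / real (Suc m)" "c i"] \<open>T > 0\<close> by simp
  qed
  have "iexp (z \<bullet> levy_sum g X T m \<omega>) = (\<Prod>i<Suc m. iexp (c i * D i \<omega>))" for \<omega>
    by (simp add: levy_sum_def D_def c_def inner_sum_right exp_sum[symmetric] sum_distrib_left mult.commute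
        del: sum.lessThan_Suc prod.lessThan_Suc of_nat_Suc)
  then have "(\<integral>\<omega>. iexp (z \<bullet> levy_sum g X T m \<omega>) \<partial>M) = (\<Prod>i<Suc m. \<integral>\<omega>. iexp (c i * D i \<omega>) \<partial>M)"
    by (simp only:) (intro indep_vars_lebesgue_integral ind, auto intro!: integrable_const_bound[of _ 1])
  also have "\<dots> = exp (\<Sum>i<Suc m. - (complex_of_real (T / real (Suc m)) * \<psi> (c i)))"
    unfolding one by (rule exp_sum[symmetric]) simp
  finally show ?thesis
    by (simp add: c_def sum_negf scaleR_conv_of_real sum_distrib_left del: sum.lessThan_Suc of_nat_Suc of_real_divide)
qed

text \<open>
  The coefficients are limits of measurable sums only almost everywhere; completeness makes up for the
  exceptional null set.
\<close>

lemma borel_measurable_completion_AE: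
  assumes f: "f \<in> borel_measurable (completion M)" and eq: "AE \<omega> in completion M. f \<omega> = g \<omega>"
  shows "g \<in> borel_measurable (completion M)"
proof (rule measurableI)
  obtain N where N: "N \<in> null_sets (completion M)" "{\<omega> \<in> space M. f \<omega> \<noteq> g \<omega>} \<subseteq> N"
    using eq unfolding eventually_ae_filter by auto
  fix A :: "'b set" assume A: "A \<in> sets borel"
  have "f -` A \<inter> space (completion M) - N \<in> sets (completion M)"
    using measurable_sets[OF f A] N(1) by auto
  moreover have "g -` A \<inter> space (completion M) \<inter> N \<in> null_sets (completion M)"
    by (rule null_sets_completion_subset[OF _ N(1)]) auto
  moreover have "g -` A \<inter> space (completion M) =
      (f -` A \<inter> space (completion M) - N) \<union> (g -` A \<inter> space (completion M) \<inter> N)"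
    using N(2) by auto
  ultimately show "g -` A \<inter> space (completion M) \<in> sets (completion M)"
    by (metis sets.Un null_setsD2)
qed simp

lemma kl_vector_as_limit:
  fixes X :: "real \<Rightarrow> 'a \<Rightarrow> real" and idx :: "'d::finite \<Rightarrow> nat"
  assumes "levy_process M X" "T > 0"
  shows "kl_vector idx X T \<in> borel_measurable (completion M)"
    and "AE \<omega> in completion M. (\<lambda>m. levy_sum (\<lambda>t. kl_kernel idx T (1, t)) X T m \<omega>) \<longlonglongrightarrow> kl_vector idx X T \<omega>"
proof -
  let ?S = "levy_sum (\<lambda>t. kl_kernel idx T (1, t)) X T"
  have [measurable]: "?S m \<in> borel_measurable M" for m
    by (rule measurable_levy_sum[OF assms(1,2)])
  have [measurable]: "?S m \<in> borel_measurable (completion M)" for m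
    by (rule measurable_completion) simp
  have lim_M: "AE \<omega> in M. (\<lambda>m. ?S m \<omega>) \<longlonglongrightarrow> kl_vector idx X T \<omega>"
  proof -
    have "AE \<omega> in M. X 0 \<omega> = 0" "AE \<omega> in M. cadlag (\<lambda>t. X t \<omega>)"
      using assms(1) by (auto simp: levy_process_def)
    then show ?thesis
      by eventually_elim (rule levy_sum_tendsto_kl_vector[OF \<open>T > 0\<close>])
  qed
  then show lim: "AE \<omega> in completion M. (\<lambda>m. ?S m \<omega>) \<longlonglongrightarrow> kl_vector idx X T \<omega>"
    by (rule AE_completion)
  show "kl_vector idx X T \<in> borel_measurable (completion M)"
  proof -
    have "(\<lambda>\<omega>. lim (\<lambda>m. ?S m \<omega>)) \<in> borel_measurable (completion M)"
      by (rule borel_measurable_lim_metric) measurable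
    moreover have "AE \<omega> in completion M. lim (\<lambda>m. ?S m \<omega>) = kl_vector idx X T \<omega>"
      using lim by eventually_elim (rule limI)
    ultimately show ?thesis
      by (rule borel_measurable_completion_AE)
  qed
qed

lemma char_kl_vector:
  fixes X :: "real \<Rightarrow> 'a \<Rightarrow> real" and idx :: "'d::finite \<Rightarrow> nat"
  assumes "levy_process M X" "T > 0"
    and char: "\<And>t z. t \<ge> 0 \<Longrightarrow> (\<integral>\<omega>. iexp (z * X t \<omega>) \<partial>M) = exp (- (complex_of_real t * \<psi> z))"
    and cont: "continuous_on UNIV \<psi>"
  shows "(\<integral>\<omega>. iexp (z \<bullet> kl_vector idx X T \<omega>) \<partial>completion M) =
      exp (- (LBINT t:{0..T}. \<psi> (z \<bullet> kl_kernel idx T (1, t))))"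
proof -
  let ?S = "levy_sum (\<lambda>t. kl_kernel idx T (1, t)) X T"
  interpret prob_space M
    using assms(1) by (simp add: levy_process_def)
  interpret C: prob_space "completion M"
    using prob_space_completion by simp
  note meas = kl_vector_as_limit(1)[OF assms(1,2), of idx] and lim = kl_vector_as_limit(2)[OF assms(1,2), of idx]
  have [measurable]: "?S m \<in> borel_measurable M" for m
    by (rule measurable_levy_sum[OF assms(1,2)])
  have [measurable]: "?S m \<in> borel_measurable (completion M)" for m
    by (rule measurable_completion) simp
  have "(\<lambda>m. \<integral>\<omega>. iexp (z \<bullet> ?S m \<omega>) \<partial>completion M) \<longlonglongrightarrow> (\<integral>\<omega>. iexp (z \<bullet> kl_vector idx X T \<omega>) \<partial>completion M)"
  proof (rule integral_dominated_convergence[where w="\<lambda>_. 1"])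
    show "AE \<omega> in completion M. (\<lambda>m. iexp (z \<bullet> ?S m \<omega>)) \<longlonglongrightarrow> iexp (z \<bullet> kl_vector idx X T \<omega>)"
      using lim by eventually_elim (intro tendsto_intros)
  qed (use meas in auto)
  moreover have "(\<integral>\<omega>. iexp (z \<bullet> ?S m \<omega>) \<partial>completion M) =
    exp (- ((T / real (Suc m)) *\<^sub>R (\<Sum>i<Suc m. \<psi> (z \<bullet> kl_kernel idx T (1, T * real i / real (Suc m))))))" for m
    using char_levy_sum[OF assms(1,2) char, of z] by (subst integral_completion) auto
  moreover have "continuous_on {0..T} (\<lambda>t. \<psi> (z \<bullet> kl_kernel idx T (1, t)))"
    by (rule continuous_on_compose2[OF cont]) (auto intro!: continuous_intros)
  from tendsto_exp[OF tendsto_minus[OF riemann_sums_tendsto_integral[OF \<open>T > 0\<close> this]]]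
  have "(\<lambda>m. exp (- ((T / real (Suc m)) *\<^sub>R (\<Sum>i<Suc m. \<psi> (z \<bullet> kl_kernel idx T (1, T * real i / real (Suc m)))))))
    \<longlonglongrightarrow> exp (- (LBINT t:{0..T}. \<psi> (z \<bullet> kl_kernel idx T (1, t))))" .
  ultimately show ?thesis
    by (simp only:) (rule LIMSEQ_unique)
qed

section \<open>Moments and infinite divisibility\<close>

text \<open>
  A bound in \<open>L\<^sup>2\<close> passes to the limit by Fatou's lemma. It also makes the sequence uniformly integrable:
  since \<open>\<bar>y\<bar> \<le> min \<bar>y\<bar> K + y\<^sup>2 / K\<close>, the part of \<open>\<bar>S\<^sub>m - Z\<bar>\<close> that escapes dominated convergence has expectation
  \<open>O(1/K)\<close> uniformly in \<open>m\<close>. Hence the means converge.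
\<close>

lemma (in prob_space) L2_bounded_convergence:
  fixes S :: "nat \<Rightarrow> 'a \<Rightarrow> real"
  assumes [measurable]: "\<And>m. S m \<in> borel_measurable M" "Z \<in> borel_measurable M"
    and lim: "AE \<omega> in M. (\<lambda>m. S m \<omega>) \<longlonglongrightarrow> Z \<omega>"
    and sq: "\<And>m. integrable M (\<lambda>\<omega>. (S m \<omega>)\<^sup>2)" "\<And>m. expectation (\<lambda>\<omega>. (S m \<omega>)\<^sup>2) \<le> C"
  shows "integrable M (\<lambda>\<omega>. (Z \<omega>)\<^sup>2)" and "integrable M Z"
    and "(\<lambda>m. expectation (S m)) \<longlonglongrightarrow> expectation Z"
proof -
  have "(\<integral>\<^sup>+ \<omega>. ennreal ((Z \<omega>)\<^sup>2) \<partial>M) = (\<integral>\<^sup>+ \<omega>. liminf (\<lambda>m. ennreal ((S m \<omega>)\<^sup>2)) \<partial>M)"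
  proof (rule nn_integral_cong_AE)
    show "AE \<omega> in M. ennreal ((Z \<omega>)\<^sup>2) = liminf (\<lambda>m. ennreal ((S m \<omega>)\<^sup>2))"
      using lim
    proof eventually_elim
      case (elim \<omega>)
      then have "(\<lambda>m. ennreal ((S m \<omega>)\<^sup>2)) \<longlonglongrightarrow> ennreal ((Z \<omega>)\<^sup>2)"
        by (intro tendsto_ennrealI tendsto_power)
      from lim_imp_Liminf[OF trivial_limit_sequentially this] show ?case ..
    qed
  qed
  also have "\<dots> \<le> liminf (\<lambda>m. \<integral>\<^sup>+ \<omega>. ennreal ((S m \<omega>)\<^sup>2) \<partial>M)"
    by (rule nn_integral_liminf) measurable
  also have "\<dots> \<le> liminf (\<lambda>m. ennreal C)"
    using sq by (intro Liminf_mono always_eventually allI) (simp add: nn_integral_eq_integral ennreal_leI)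
  also have "\<dots> < \<infinity>"
    by (simp add: Liminf_const)
  finally show Z2: "integrable M (\<lambda>\<omega>. (Z \<omega>)\<^sup>2)"
    by (intro integrableI_bounded) auto
  then show Z1: "integrable M Z"
    by (rule square_integrable_imp_integrable[OF assms(2)])
  have S1: "integrable M (S m)" for m
    by (rule square_integrable_imp_integrable[OF assms(1) sq(1)])
  define C' where "C' = 2 * C + 2 * expectation (\<lambda>\<omega>. (Z \<omega>)\<^sup>2)"
  have sq_le: "(s - z)\<^sup>2 \<le> 2 * s\<^sup>2 + 2 * z\<^sup>2" for s z :: real
    using zero_le_power2[of "s + z"] by (simp add: power2_sum power2_diff)
  have D2: "integrable M (\<lambda>\<omega>. (S m \<omega> - Z \<omega>)\<^sup>2)" for m
    by (rule Bochner_Integration.integrable_bound[where f="\<lambda>\<omega>. 2 * (S m \<omega>)\<^sup>2 + 2 * (Z \<omega>)\<^sup>2"])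
       (use sq(1) Z2 sq_le in auto)
  have D2_le: "expectation (\<lambda>\<omega>. (S m \<omega> - Z \<omega>)\<^sup>2) \<le> C'" for m
  proof -
    have "expectation (\<lambda>\<omega>. (S m \<omega> - Z \<omega>)\<^sup>2) \<le> expectation (\<lambda>\<omega>. 2 * (S m \<omega>)\<^sup>2 + 2 * (Z \<omega>)\<^sup>2)"
      by (intro integral_mono D2 sq_le) (use sq(1) Z2 in auto)
    also have "\<dots> \<le> C'"
      using sq Z2 by (simp add: C'_def)
    finally show ?thesis .
  qed
  have C'0: "0 \<le> C'"
    using D2_le[of 0] by (meson Bochner_Integration.integral_nonneg order_trans zero_le_power2)
  have "(\<lambda>m. expectation (\<lambda>\<omega>. \<bar>S m \<omega> - Z \<omega>\<bar>)) \<longlonglongrightarrow> 0"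
  proof (rule LIMSEQ_I)
    fix e :: real assume e: "e > 0"
    (* large enough that the tail C' / K is below e / 2; the 1 keeps K positive when C' = 0 *)
    define K where "K = 2 * C' / e + 1"
    have K: "K > 0"
      using C'0 e by (simp add: K_def add_nonneg_pos)
    have "C' < e / 2 * K"
      using e by (simp add: K_def field_simps)
    then have CK: "C' / K < e / 2"
      using K by (simp add: field_simps)
    have "(\<lambda>m. expectation (\<lambda>\<omega>. min \<bar>S m \<omega> - Z \<omega>\<bar> K)) \<longlonglongrightarrow> expectation (\<lambda>\<omega>. 0)"
    proof (rule integral_dominated_convergence[where w="\<lambda>_. K"])
      show "AE \<omega> in M. (\<lambda>m. min \<bar>S m \<omega> - Z \<omega>\<bar> K) \<longlonglongrightarrow> 0"
        using lim
      proof eventually_elim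
        case (elim \<omega>)
        have "(\<lambda>m. min \<bar>S m \<omega> - Z \<omega>\<bar> K) \<longlonglongrightarrow> min \<bar>Z \<omega> - Z \<omega>\<bar> K"
          by (intro tendsto_min tendsto_rabs tendsto_diff tendsto_const elim)
        then show ?case
          using K by simp
      qed
    qed (use K in auto)
    from LIMSEQ_D[OF this, of "e / 2"] e obtain m0 where
      m0: "\<And>m. m \<ge> m0 \<Longrightarrow> \<bar>expectation (\<lambda>\<omega>. min \<bar>S m \<omega> - Z \<omega>\<bar> K)\<bar> < e / 2"
      by auto
    have "\<bar>expectation (\<lambda>\<omega>. \<bar>S m \<omega> - Z \<omega>\<bar>)\<bar> < e" if "m \<ge> m0" for m
    proof -
      have min_int: "integrable M (\<lambda>\<omega>. min \<bar>S m \<omega> - Z \<omega>\<bar> K)"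
        using K by (intro integrable_const_bound[of _ K]) auto
      have "expectation (\<lambda>\<omega>. \<bar>S m \<omega> - Z \<omega>\<bar>) \<le>
          expectation (\<lambda>\<omega>. min \<bar>S m \<omega> - Z \<omega>\<bar> K + (S m \<omega> - Z \<omega>)\<^sup>2 / K)"
      proof (rule integral_mono)
        fix \<omega>
        show "\<bar>S m \<omega> - Z \<omega>\<bar> \<le> min \<bar>S m \<omega> - Z \<omega>\<bar> K + (S m \<omega> - Z \<omega>)\<^sup>2 / K"
        proof (cases "\<bar>S m \<omega> - Z \<omega>\<bar> \<le> K")
          case False
          then have "K * \<bar>S m \<omega> - Z \<omega>\<bar> \<le> \<bar>S m \<omega> - Z \<omega>\<bar> * \<bar>S m \<omega> - Z \<omega>\<bar>"
            by (intro mult_right_mono) auto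
          then have "\<bar>S m \<omega> - Z \<omega>\<bar> \<le> (S m \<omega> - Z \<omega>)\<^sup>2 / K"
            using K by (simp add: pos_le_divide_eq power2_eq_square mult.commute flip: abs_mult)
          then show ?thesis
            using K by simp
        qed (use K in simp)
      qed (use S1 Z1 D2 min_int in auto)
      also have "\<dots> = expectation (\<lambda>\<omega>. min \<bar>S m \<omega> - Z \<omega>\<bar> K) + expectation (\<lambda>\<omega>. (S m \<omega> - Z \<omega>)\<^sup>2) / K"
        using min_int D2 by simp
      also have "\<dots> \<le> expectation (\<lambda>\<omega>. min \<bar>S m \<omega> - Z \<omega>\<bar> K) + C' / K"
        using D2_le[of m] K by (simp add: divide_right_mono)
      finally have "expectation (\<lambda>\<omega>. \<bar>S m \<omega> - Z \<omega>\<bar>) \<le> expectation (\<lambda>\<omega>. min \<bar>S m \<omega> - Z \<omega>\<bar> K) + C' / K" .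
      moreover have "0 \<le> expectation (\<lambda>\<omega>. \<bar>S m \<omega> - Z \<omega>\<bar>)"
        by simp
      ultimately show ?thesis
        using m0[OF that] CK by linarith
    qed
    then show "\<exists>m0. \<forall>m\<ge>m0. norm (expectation (\<lambda>\<omega>. \<bar>S m \<omega> - Z \<omega>\<bar>) - 0) < e"
      by auto
  qed
  moreover have "\<bar>expectation (S m) - expectation Z\<bar> \<le> expectation (\<lambda>\<omega>. \<bar>S m \<omega> - Z \<omega>\<bar>)" for m
    using integral_abs_bound[of M "\<lambda>\<omega>. S m \<omega> - Z \<omega>"] S1 Z1 by simp
  ultimately have "(\<lambda>m. expectation (S m) - expectation Z) \<longlonglongrightarrow> 0"
    by (rule_tac Lim_null_comparison[OF always_eventually]) auto
  then show "(\<lambda>m. expectation (S m)) \<longlonglongrightarrow> expectation Z"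
    by (simp add: LIM_zero_iff)
qed

text \<open>
  Centred independent increments are orthogonal, so only the diagonal of the squared sum contributes.
\<close>

lemma levy_sum_moments:
  fixes X :: "real \<Rightarrow> 'a \<Rightarrow> real" and g :: "real \<Rightarrow> real"
  assumes "class_K M X" "T > 0"
  shows "integrable M (levy_sum g X T m)" and "(\<integral>\<omega>. levy_sum g X T m \<omega> \<partial>M) = 0"
    and "integrable M (\<lambda>\<omega>. (levy_sum g X T m \<omega>)\<^sup>2)"
    and "(\<integral>\<omega>. (levy_sum g X T m \<omega>)\<^sup>2 \<partial>M) =
      (\<integral>\<omega>. (X (T / real (Suc m)) \<omega>)\<^sup>2 \<partial>M) * (\<Sum>i<Suc m. (g (T * real i / real (Suc m)))\<^sup>2)"
proof -
  have lp: "levy_process M X"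
    using assms(1) by (simp add: class_K_def)
  interpret prob_space M
    using lp by (simp add: levy_process_def)
  define D where "D i \<omega> = X (T * real (Suc i) / real (Suc m)) \<omega> - X (T * real i / real (Suc m)) \<omega>" for i \<omega>
  define a where "a i = g (T * real i / real (Suc m))" for i
  define \<tau> where "\<tau> = T / real (Suc m)"
  note D = levy_grid_increments[OF lp \<open>T > 0\<close>, where m=m, folded D_def \<tau>_def]
  have [measurable]: "D i \<in> borel_measurable M" for i
    using D(3)[of i] by (simp add: D_def[abs_def])
  have D_law: "distr M borel (D i) = distr M borel (X \<tau>)" for i
    using D(2)[of i] by (simp add: D_def[abs_def])
  have "\<tau> \<ge> 0"
    using \<open>T > 0\<close> by (simp add: \<tau>_def)
  then have X\<tau>: "integrable M (X \<tau>)" "(\<integral>\<omega>. X \<tau> \<omega> \<partial>M) = 0" "integrable M (\<lambda>\<omega>. (X \<tau> \<omega>)\<^sup>2)"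
    using assms(1) by (auto simp: class_K_def)
  then have [measurable]: "X \<tau> \<in> borel_measurable M"
    by auto
  have D_int: "integrable M (\<lambda>\<omega>. f (D i \<omega>)) \<longleftrightarrow> integrable M (\<lambda>\<omega>. f (X \<tau> \<omega>))"
    and D_exp: "(\<integral>\<omega>. f (D i \<omega>) \<partial>M) = (\<integral>\<omega>. f (X \<tau> \<omega>) \<partial>M)"
    if [measurable]: "f \<in> borel_measurable borel" for f :: "real \<Rightarrow> real" and i
    using integrable_distr_eq[of "D i" M borel f] integrable_distr_eq[of "X \<tau>" M borel f]
      integral_distr[of "D i" M borel f] integral_distr[of "X \<tau>" M borel f] D_law[of i] by simp_all
  have D1: "integrable M (D i)" "expectation (D i) = 0" for i
    using D_int[of "\<lambda>x. x" i] D_exp[of "\<lambda>x. x" i] X\<tau> by simp_all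
  have DD: "integrable M (\<lambda>\<omega>. D i \<omega> * D k \<omega>) \<and>
      expectation (\<lambda>\<omega>. D i \<omega> * D k \<omega>) = (if i = k then expectation (\<lambda>\<omega>. (X \<tau> \<omega>)\<^sup>2) else 0)"
    if "i < Suc m" "k < Suc m" for i k
  proof (cases "i = k")
    case True
    then show ?thesis
      using D_int[of "\<lambda>x. x\<^sup>2" i] D_exp[of "\<lambda>x. x\<^sup>2" i] X\<tau> by (simp add: power2_eq_square)
  next
    case False
    have "indep_vars (\<lambda>_. borel) D {i, k}"
      by (rule indep_vars_subset[of _ _ "{..<Suc m}"]) (use D(1) that in \<open>auto simp: D_def[abs_def]\<close>)
    then show ?thesis
      using indep_vars_lebesgue_integral[of "{i, k}" D] indep_vars_integrable[of "{i, k}" D] D1 False by simp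
  qed
  have S: "levy_sum g X T m \<omega> = (\<Sum>i<Suc m. a i * D i \<omega>)" for \<omega>
    by (simp add: levy_sum_def D_def a_def mult.commute del: sum.lessThan_Suc of_nat_Suc)
  have S2: "(levy_sum g X T m \<omega>)\<^sup>2 = (\<Sum>i<Suc m. \<Sum>k<Suc m. a i * a k * (D i \<omega> * D k \<omega>))" for \<omega>
    unfolding S power2_eq_square sum_product by (intro sum.cong refl) simp
  show "integrable M (levy_sum g X T m)" "(\<integral>\<omega>. levy_sum g X T m \<omega> \<partial>M) = 0"
    unfolding S using D1 by (simp_all add: S[abs_def] del: sum.lessThan_Suc)
  have ints: "integrable M (\<lambda>\<omega>. a i * a k * (D i \<omega> * D k \<omega>))" if "i < Suc m" "k < Suc m" for i k
    using DD[OF that] by simp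
  show "integrable M (\<lambda>\<omega>. (levy_sum g X T m \<omega>)\<^sup>2)"
    unfolding S2 by (intro Bochner_Integration.integrable_sum ints) auto
  have "(\<integral>\<omega>. (levy_sum g X T m \<omega>)\<^sup>2 \<partial>M) = (\<Sum>i<Suc m. \<Sum>k<Suc m. expectation (\<lambda>\<omega>. a i * a k * (D i \<omega> * D k \<omega>)))"
    unfolding S2 by (subst Bochner_Integration.integral_sum, intro Bochner_Integration.integrable_sum ints, simp, simp,
        intro sum.cong refl Bochner_Integration.integral_sum ints) auto
  also have "\<dots> = (\<Sum>i<Suc m. \<Sum>k<Suc m. if k = i then (a i)\<^sup>2 * expectation (\<lambda>\<omega>. (X \<tau> \<omega>)\<^sup>2) else 0)"
    using DD by (intro sum.cong refl) (auto simp: power2_eq_square)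
  also have "\<dots> = expectation (\<lambda>\<omega>. (X \<tau> \<omega>)\<^sup>2) * (\<Sum>i<Suc m. (a i)\<^sup>2)"
    by (simp add: sum.delta sum_distrib_left mult.commute del: sum.lessThan_Suc)
  finally show "(\<integral>\<omega>. (levy_sum g X T m \<omega>)\<^sup>2 \<partial>M) =
      (\<integral>\<omega>. (X (T / real (Suc m)) \<omega>)\<^sup>2 \<partial>M) * (\<Sum>i<Suc m. (g (T * real i / real (Suc m)))\<^sup>2)"
    by (simp only: \<tau>_def a_def)
qed

text \<open>
  The constant weight \<open>1\<close> makes the sum telescope to \<open>X\<^sub>T\<close>. The formula for second moments, read in this
  case, gives the variance of one increment and with it a bound that does not depend on the number of cells.
\<close>

lemma levy_sum_second_moment_le:
  fixes X :: "real \<Rightarrow> 'a \<Rightarrow> real" and g :: "real \<Rightarrow> real"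
  assumes "class_K M X" "T > 0" and B: "\<And>t. 0 \<le> t \<Longrightarrow> t \<le> T \<Longrightarrow> \<bar>g t\<bar> \<le> B"
  shows "(\<integral>\<omega>. (levy_sum g X T m \<omega>)\<^sup>2 \<partial>M) \<le> B\<^sup>2 * (\<integral>\<omega>. (X T \<omega>)\<^sup>2 \<partial>M)"
proof -
  let ?v = "\<integral>\<omega>. (X (T / real (Suc m)) \<omega>)\<^sup>2 \<partial>M"
  have lp: "levy_process M X"
    using assms(1) by (simp add: class_K_def)
  have meas: "X t \<in> borel_measurable M" if "t \<ge> 0" for t
    using lp that by (simp add: levy_process_def)
  have "AE \<omega> in M. X 0 \<omega> = 0"
    using lp by (simp add: levy_process_def)
  then have "AE \<omega> in M. (levy_sum (\<lambda>_. 1) X T m \<omega>)\<^sup>2 = (X T \<omega>)\<^sup>2"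
  proof eventually_elim
    case (elim \<omega>)
    have "levy_sum (\<lambda>_. 1) X T m \<omega> = X T \<omega>"
      using sum_lessThan_telescope[of "\<lambda>i. X (T * real i / real (Suc m)) \<omega>" "Suc m"] elim
      by (simp add: levy_sum_def del: sum.lessThan_Suc of_nat_Suc)
    then show ?case
      by simp
  qed
  then have "(\<integral>\<omega>. (levy_sum (\<lambda>_. 1) X T m \<omega>)\<^sup>2 \<partial>M) = (\<integral>\<omega>. (X T \<omega>)\<^sup>2 \<partial>M)"
    using \<open>T > 0\<close> by (intro integral_cong_AE borel_measurable_power meas measurable_levy_sum[OF lp \<open>T > 0\<close>]) auto
  then have v: "?v * real (Suc m) = (\<integral>\<omega>. (X T \<omega>)\<^sup>2 \<partial>M)"
    using levy_sum_moments(4)[OF assms(1,2), of "\<lambda>_. 1" m] by (simp del: sum.lessThan_Suc of_nat_Suc)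
  have "(\<Sum>i<Suc m. (g (T * real i / real (Suc m)))\<^sup>2) \<le> (\<Sum>i<Suc m. B\<^sup>2)"
  proof (rule sum_mono)
    fix i assume "i \<in> {..<Suc m}"
    then have "real i / real (Suc m) \<le> 1"
      by (simp add: divide_le_eq)
    then have "T * (real i / real (Suc m)) \<le> T"
      using \<open>T > 0\<close> by (intro mult_left_le) auto
    then have "\<bar>g (T * real i / real (Suc m))\<bar> \<le> B"
      using \<open>T > 0\<close> by (intro B) auto
    then show "(g (T * real i / real (Suc m)))\<^sup>2 \<le> B\<^sup>2"
      by (metis abs_ge_zero power2_abs power_mono)
  qed
  then have "?v * (\<Sum>i<Suc m. (g (T * real i / real (Suc m)))\<^sup>2) \<le> ?v * (real (Suc m) * B\<^sup>2)"
    by (intro mult_left_mono) (auto simp del: of_nat_Suc sum.lessThan_Suc)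
  also have "\<dots> = B\<^sup>2 * (\<integral>\<omega>. (X T \<omega>)\<^sup>2 \<partial>M)"
    using v by (simp add: mult.commute mult.left_commute del: of_nat_Suc)
  finally show ?thesis
    using levy_sum_moments(4)[OF assms(1,2), of g m] by simp
qed

lemma levy_process_rescale_time:
  assumes "levy_process M X" "c > 0"
  shows "levy_process M (\<lambda>t. X (t * c))"
  unfolding levy_process_def
proof (intro conjI allI impI)
  note lp = assms(1)[unfolded levy_process_def]
  show "prob_space M"
    using lp by (elim conjE)
  show "X (t * c) \<in> borel_measurable M" if "t \<ge> 0" for t
    using lp that \<open>c > 0\<close> by simp
  show "AE \<omega> in M. X (0 * c) \<omega> = 0"
    using lp by simp
  show "prob_space.indep_vars M (\<lambda>_. borel) (\<lambda>i \<omega>. X (t (Suc i) * c) \<omega> - X (t i * c) \<omega>) {..<n}"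
    if "0 \<le> t 0 \<and> (\<forall>i<n. t i < t (Suc i))" for n :: nat and t :: "nat \<Rightarrow> real"
  proof -
    have "0 \<le> t 0 * c \<and> (\<forall>i<n. t i * c < t (Suc i) * c)"
      using that \<open>c > 0\<close> by simp
    moreover have "\<forall>(n::nat) (t::nat \<Rightarrow> real). 0 \<le> t 0 \<and> (\<forall>i<n. t i < t (Suc i)) \<longrightarrow>
      prob_space.indep_vars M (\<lambda>_. borel) (\<lambda>i \<omega>. X (t (Suc i)) \<omega> - X (t i) \<omega>) {..<n}"
      using lp by (elim conjE)
    ultimately show ?thesis
      by (elim allE[of _ n] allE[of _ "\<lambda>i. t i * c"] impE)
  qed
  show "distr M borel (\<lambda>\<omega>. X ((s + h) * c) \<omega> - X (s * c) \<omega>) = distr M borel (X (h * c))"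
    if "s \<ge> 0" "h \<ge> 0" for s h
    using lp that \<open>c > 0\<close> by (simp add: distrib_right)
  have "AE \<omega> in M. cadlag (\<lambda>t. X t \<omega>)"
    using lp by (elim conjE)
  then show "AE \<omega> in M. cadlag (\<lambda>t. X (t * c) \<omega>)"
  proof eventually_elim
    case (elim \<omega>)
    have right: "filterlim (\<lambda>t. t * c) (at_right (t * c)) (at_right t)" for t
      using \<open>c > 0\<close> by (auto simp: filterlim_at eventually_at_filter intro!: tendsto_intros)
    have left: "filterlim (\<lambda>t. t * c) (at_left (t * c)) (at_left t)" for t
      using \<open>c > 0\<close> by (auto simp: filterlim_at eventually_at_filter intro!: tendsto_intros)
    show ?case
      unfolding cadlag_def
    proof (intro conjI allI impI)
      fix t :: real assume "t \<ge> 0"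
      then have "((\<lambda>t. X t \<omega>) \<longlongrightarrow> X (t * c) \<omega>) (at_right (t * c))"
        using elim \<open>c > 0\<close> by (simp add: cadlag_def)
      then show "((\<lambda>t. X (t * c) \<omega>) \<longlongrightarrow> X (t * c) \<omega>) (at_right t)"
        by (rule filterlim_compose[OF _ right])
    next
      fix t :: real assume "t > 0"
      then have "t * c > 0"
        using \<open>c > 0\<close> by simp
      then obtain l where "((\<lambda>t. X t \<omega>) \<longlongrightarrow> l) (at_left (t * c))"
        using elim unfolding cadlag_def by blast
      then show "\<exists>l. ((\<lambda>t. X (t * c) \<omega>) \<longlongrightarrow> l) (at_left t)"
        by (intro exI[of _ l] filterlim_compose[OF _ left])
    qed
  qed
qed

text \<open>
  The \<open>n\<close>-th convolution root of the law of the coefficient vector is the law of the coefficient vector of the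
  process slowed down by the factor \<open>n\<close>.
\<close>

lemma class_C_kl_vector:
  fixes idx :: "'d::finite \<Rightarrow> nat"
  assumes K: "class_K M X" and "T > 0"
    and char: "\<And>t z. t \<ge> 0 \<Longrightarrow> (\<integral>\<omega>. iexp (z * X t \<omega>) \<partial>M) = exp (- (complex_of_real t * \<psi> z))"
    and cont: "continuous_on UNIV \<psi>"
  shows "class_C (completion M) (kl_vector idx X T)"
proof -
  let ?Z = "kl_vector idx X T" and ?N = "completion M"
  let ?g = "\<lambda>t. kl_kernel idx T (1, t)"
  have lp: "levy_process M X"
    using K by (simp add: class_K_def)
  interpret M: prob_space M
    using lp by (simp add: levy_process_def)
  interpret prob_space ?N
    by (rule M.prob_space_completion)
  note Z = kl_vector_as_limit[OF lp \<open>T > 0\<close>, of idx]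
  have [measurable]: "?Z \<in> borel_measurable ?N"
    by (rule Z(1))
  have "infinitely_divisible ?N ?Z"
    unfolding infinitely_divisible_def
  proof (intro conjI allI impI)
    fix n :: nat assume n: "n \<ge> 1"
    (* slowing time down divides the exponent by n *)
    define Y where "Y t = X (t * (1 / real n))" for t
    have Y: "levy_process M Y"
      unfolding Y_def[abs_def] using n by (intro levy_process_rescale_time lp) simp
    have Y_char: "(\<integral>\<omega>. iexp (z * Y t \<omega>) \<partial>M) = exp (- (complex_of_real t * (\<psi> z / complex_of_real (real n))))"
      if "t \<ge> 0" for t z
      using char[of "t * (1 / real n)" z] that by (simp add: Y_def)
    have cont': "continuous_on UNIV (\<lambda>z. \<psi> z / complex_of_real (real n))"
      using n by (intro continuous_intros cont) auto
    note YZ = char_kl_vector[OF Y \<open>T > 0\<close> Y_char cont', where idx=idx]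
    have [measurable]: "kl_vector idx Y T \<in> borel_measurable ?N"
      by (rule kl_vector_as_limit(1)[OF Y \<open>T > 0\<close>])
    define \<mu> where "\<mu> = distr ?N borel (kl_vector idx Y T)"
    have sets_\<mu> [measurable_cong]: "sets \<mu> = sets borel"
      by (simp add: \<mu>_def)
    interpret \<mu>: prob_space \<mu>
      unfolding \<mu>_def by (rule prob_space_distr) measurable
    interpret P: product_prob_space "\<lambda>_::nat. \<mu>" "{..<n}"
      by standard
    have sum_meas [measurable]: "(\<lambda>y. \<Sum>i<n. y i) \<in> borel_measurable (PiM {..<n} (\<lambda>_. \<mu>))"
    proof (rule borel_measurable_sum)
      fix i assume "i \<in> {..<n}"
      then have "(\<lambda>y. y i) \<in> measurable (PiM {..<n} (\<lambda>_. \<mu>)) \<mu>"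
        by (rule measurable_component_singleton)
      then show "(\<lambda>y. y i) \<in> borel_measurable (PiM {..<n} (\<lambda>_. \<mu>))"
        by (simp only: measurable_cong_sets[OF refl sets_\<mu>])
    qed
    have "distr ?N borel ?Z = distr (PiM {..<n} (\<lambda>_. \<mu>)) borel (\<lambda>y. \<Sum>i<n. y i)"
    proof (rule char_unique_euclidean)
      show "finite_measure (distr ?N borel ?Z)"
        using prob_space_distr[of ?Z borel] by (simp add: prob_space.finite_measure)
      show "finite_measure (distr (PiM {..<n} (\<lambda>_. \<mu>)) borel (\<lambda>y. \<Sum>i<n. y i))"
        using P.prob_space_distr[OF sum_meas] by (simp add: prob_space.finite_measure)
      fix z :: "real ^ 'd"
      let ?J = "LBINT t:{0..T}. \<psi> (z \<bullet> ?g t)"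
      have \<mu>_char: "(\<integral>y. iexp (z \<bullet> y) \<partial>\<mu>) = exp (- (?J / complex_of_real (real n)))"
        unfolding \<mu>_def using YZ[of z]
        by (subst integral_distr) (auto simp: set_lebesgue_integral_def)
      have "(\<integral>y. iexp (z \<bullet> y) \<partial>distr (PiM {..<n} (\<lambda>_. \<mu>)) borel (\<lambda>y. \<Sum>i<n. y i)) =
          (\<integral>y. iexp (z \<bullet> (\<Sum>i<n. y i)) \<partial>PiM {..<n} (\<lambda>_. \<mu>))"
        by (subst integral_distr) auto
      also have "\<dots> = (\<integral>y. (\<Prod>i<n. iexp (z \<bullet> y i)) \<partial>PiM {..<n} (\<lambda>_. \<mu>))"
        by (simp add: inner_sum_right sum_distrib_left exp_sum)
      also have "\<dots> = (\<Prod>i<n. \<integral>y. iexp (z \<bullet> y) \<partial>\<mu>)"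
        by (rule P.product_integral_prod) (auto intro!: \<mu>.integrable_const_bound[of _ 1])
      also have "\<dots> = exp (- ?J)"
        using n by (simp add: \<mu>_char exp_of_nat_mult[symmetric])
      also have "\<dots> = (\<integral>y. iexp (z \<bullet> y) \<partial>distr ?N borel ?Z)"
        by (subst integral_distr) (auto simp: char_kl_vector[OF lp \<open>T > 0\<close> char cont])
      finally show "(\<integral>y. iexp (z \<bullet> y) \<partial>distr ?N borel ?Z) =
          (\<integral>y. iexp (z \<bullet> y) \<partial>distr (PiM {..<n} (\<lambda>_. \<mu>)) borel (\<lambda>y. \<Sum>i<n. y i))" ..
    qed simp_all
    then show "\<exists>\<mu>. prob_space \<mu> \<and> sets \<mu> = sets borel \<and>
        distr ?N borel ?Z = distr (PiM {..<n} (\<lambda>_. \<mu>)) borel (\<lambda>y. \<Sum>i<n. y i)"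
      using \<mu>.prob_space_axioms sets_\<mu> by blast
  qed (rule prob_space_axioms Z(1))+
  moreover have "integrable ?N (\<lambda>\<omega>. ?Z \<omega> $ j) \<and> (\<integral>\<omega>. ?Z \<omega> $ j \<partial>?N) = 0 \<and> integrable ?N (\<lambda>\<omega>. (?Z \<omega> $ j)\<^sup>2)" for j
  proof -
    obtain C where C: "C \<ge> 1" "\<And>x t. 0 \<le> t \<Longrightarrow> t \<le> T \<Longrightarrow> norm (kl_kernel idx T (x, t)) \<le> C * \<bar>x\<bar>"
      using norm_kl_kernel_le by blast
    let ?gj = "\<lambda>t. ?g t $ j"
    let ?S = "levy_sum ?gj X T"
    have gj: "\<bar>?gj t\<bar> \<le> C" if "0 \<le> t" "t \<le> T" for t
      using C(2)[OF that, of 1] component_le_norm_cart[of "?g t" j] by simp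
    have S_meas: "?S m \<in> borel_measurable M" for m
      by (rule measurable_levy_sum[OF lp \<open>T > 0\<close>])
    have sq_meas: "(\<lambda>\<omega>. (?S m \<omega>)\<^sup>2) \<in> borel_measurable M" for m
      by (intro borel_measurable_power S_meas)
    have lim: "AE \<omega> in ?N. (\<lambda>m. ?S m \<omega>) \<longlonglongrightarrow> ?Z \<omega> $ j"
      using Z(2)
    proof eventually_elim
      case (elim \<omega>)
      then have "(\<lambda>m. levy_sum ?g X T m \<omega> $ j) \<longlonglongrightarrow> ?Z \<omega> $ j"
        by (rule tendsto_vec_nth)
      then show ?case
        by (simp add: levy_sum_def del: sum.lessThan_Suc of_nat_Suc)
    qed
    have Zj: "(\<lambda>\<omega>. ?Z \<omega> $ j) \<in> borel_measurable ?N"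
      by (rule borel_measurable_continuous_on[where f="\<lambda>v. v $ j", OF _ Z(1)]) (intro continuous_intros)
    have sq: "integrable ?N (\<lambda>\<omega>. (?S m \<omega>)\<^sup>2)" for m
      using levy_sum_moments(3)[OF K \<open>T > 0\<close>] by (simp only: integrable_completion[OF sq_meas])
    have sq_le: "(\<integral>\<omega>. (?S m \<omega>)\<^sup>2 \<partial>?N) \<le> C\<^sup>2 * (\<integral>\<omega>. (X T \<omega>)\<^sup>2 \<partial>M)" for m
      using levy_sum_second_moment_le[OF K \<open>T > 0\<close> gj, where m=m] by (simp only: integral_completion[OF sq_meas])
    have "(\<integral>\<omega>. ?S m \<omega> \<partial>?N) = 0" for m
      using levy_sum_moments(2)[OF K \<open>T > 0\<close>] by (simp only: integral_completion[OF S_meas])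
    then have "(\<integral>\<omega>. ?Z \<omega> $ j \<partial>?N) = 0"
      using L2_bounded_convergence(3)[OF measurable_completion[OF S_meas] Zj lim sq sq_le] by (simp add: LIMSEQ_const_iff)
    then show ?thesis
      using L2_bounded_convergence(1,2)[OF measurable_completion[OF S_meas] Zj lim sq sq_le] by simp
  qed
  ultimately show ?thesis
    by (simp add: class_C_def)
qed

section \<open>Integrals with respect to the Levy measures\<close>

text \<open>
  The two Taylor bounds for \<open>exp(i y) - 1 - i y\<close>, quadratic for small and linear for large jumps, combined
  into one dominating function that is locally uniform in \<open>z\<close>.
\<close>

lemma norm_levy_integrand_le:
  "norm (levy_integrand (\<lambda>_. 1) z x) \<le> 2 * (1 + norm z)\<^sup>2 * min ((norm x)\<^sup>2) (norm x)"
proof -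
  let ?y = "z \<bullet> x"
  have y: "\<bar>?y\<bar> \<le> norm z * norm x"
    by (rule Cauchy_Schwarz_ineq2)
  have z: "norm z \<le> (1 + norm z)\<^sup>2" "(norm z)\<^sup>2 \<le> 2 * (1 + norm z)\<^sup>2"
    using norm_ge_zero[of z] zero_le_power2[of "norm z"] unfolding power2_sum by simp_all
  have eq: "levy_integrand (\<lambda>_. 1) z x = iexp ?y - (\<Sum>k\<le>1. (\<i> * complex_of_real ?y) ^ k / fact k)"
    by (simp add: levy_integrand_def)
  have "norm (levy_integrand (\<lambda>_. 1) z x) \<le> \<bar>?y\<bar>\<^sup>2 / 2"
    unfolding eq using iexp_approx1[of ?y 1] by (simp add: numeral_2_eq_2)
  also have "\<dots> \<le> (norm z * norm x)\<^sup>2"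
    using power_mono[OF y abs_ge_zero, of 2] zero_le_power2[of "\<bar>?y\<bar>"] by linarith
  also have "\<dots> \<le> 2 * (1 + norm z)\<^sup>2 * (norm x)\<^sup>2"
    using mult_right_mono[OF z(2), of "(norm x)\<^sup>2"] by (simp add: power_mult_distrib)
  finally have 1: "norm (levy_integrand (\<lambda>_. 1) z x) \<le> 2 * (1 + norm z)\<^sup>2 * (norm x)\<^sup>2" .
  have "norm (levy_integrand (\<lambda>_. 1) z x) \<le> 2 * \<bar>?y\<bar>"
    unfolding eq using iexp_approx2[of ?y 1] by simp
  also have "\<dots> \<le> 2 * (norm z * norm x)"
    using y by simp
  also have "\<dots> \<le> 2 * (1 + norm z)\<^sup>2 * norm x"
    using mult_right_mono[OF z(1), of "norm x"] by simp
  finally show ?thesis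
    using 1 by (simp add: min_def)
qed

lemma measurable_levy_integrand [measurable]:
  "levy_integrand (\<lambda>_. 1) z \<in> borel_measurable borel"
  unfolding levy_integrand_def by measurable

lemma borel_measurable_levy_measure:
  assumes "levy_measure \<nu>" "f \<in> borel_measurable borel"
  shows "f \<in> borel_measurable \<nu>"
proof -
  have "sets \<nu> = sets (restrict_space borel (- {0}))"
    using assms(1) by (simp add: levy_measure_def)
  then show ?thesis
    using measurable_restrict_space1[OF assms(2)] by (simp cong: measurable_cong_sets)
qed

text \<open>
  With cut-off \<open>1\<close>, integrability of the Levy integrand forces the large jumps to have a first moment, because
  \<open>\<bar>x\<bar> \<le> \<bar>exp(i x) - 1 - i x\<bar> + 2\<close>. This turns a hypothesis on the triple into integrability of the dominating
  function in \<open>norm_levy_integrand_le\<close>.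
\<close>

lemma integrable_min_square_norm:
  fixes \<nu> :: "real measure"
  assumes \<nu>: "levy_measure \<nu>" and int: "integrable \<nu> (levy_integrand (\<lambda>_. 1) 1)"
  shows "integrable \<nu> (\<lambda>x. min ((norm x)\<^sup>2) (norm x))"
proof (rule Bochner_Integration.integrable_bound)
  note [measurable] = borel_measurable_levy_measure[OF \<nu>]
  have "integrable \<nu> (\<lambda>x. min 1 ((norm x)\<^sup>2))"
    using \<nu> by (intro integrableI_bounded) (auto simp: levy_measure_def)
  then show "integrable \<nu> (\<lambda>x. 3 * min 1 ((norm x)\<^sup>2) + norm (levy_integrand (\<lambda>_. 1) 1 x))"
    using int by simp
  (* the coefficient 3 leaves room: small jumps need 1, and large ones the 2 from the triangle inequality *)
  have "min ((norm x)\<^sup>2) (norm x) \<le> 3 * min 1 ((norm x)\<^sup>2) + norm (levy_integrand (\<lambda>_. 1) 1 x)" for x :: real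
  proof (cases "\<bar>x\<bar> \<le> 1")
    case True
    then have "x\<^sup>2 \<le> 1"
      by (simp add: abs_square_le_1)
    then have "min 1 ((norm x)\<^sup>2) = x\<^sup>2"
      by simp
    then have "min ((norm x)\<^sup>2) (norm x) \<le> 3 * min 1 ((norm x)\<^sup>2)"
      by (simp only:) (intro min.coboundedI1, simp)
    then show ?thesis
      by (meson add_increasing2 norm_ge_zero)
  next
    case False
    then have "1 \<le> \<bar>x\<bar>\<^sup>2"
      by (intro one_le_power) simp
    then have 1: "min 1 ((norm x)\<^sup>2) = 1"
      by simp
    have "\<bar>x\<bar> = norm (- (\<i> * complex_of_real x))"
      by (simp add: norm_mult)
    also have "\<dots> = norm (levy_integrand (\<lambda>_. 1) 1 x + (1 - iexp x))"
      by (simp add: levy_integrand_def)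
    also have "\<dots> \<le> norm (levy_integrand (\<lambda>_. 1) 1 x) + norm (1 - iexp x)"
      by (rule norm_triangle_ineq)
    also have "norm (1 - iexp x) \<le> 2"
      using norm_triangle_ineq4[of 1 "iexp x"] by simp
    finally have "\<bar>x\<bar> \<le> norm (levy_integrand (\<lambda>_. 1) 1 x) + 2" by simp
    then show ?thesis
      unfolding 1 by (intro min.coboundedI2) simp
  qed
  then show "AE x in \<nu>. norm (min ((norm x)\<^sup>2) (norm x)) \<le>
      norm (3 * min 1 ((norm x)\<^sup>2) + norm (levy_integrand (\<lambda>_. 1) 1 x))"
    by (intro AE_I2) (simp add: abs_of_nonneg)
  show "(\<lambda>x. min ((norm x)\<^sup>2) (norm x)) \<in> borel_measurable \<nu>"
    by measurable
qed

lemma continuous_on_char_exponent: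
  fixes \<nu> :: "real measure"
  assumes \<nu>: "levy_measure \<nu>" and int: "integrable \<nu> (\<lambda>x. min ((norm x)\<^sup>2) (norm x))"
  shows "continuous_on UNIV (char_exponent (\<lambda>_. 1) 0 (\<lambda>z. \<sigma>\<^sup>2 * z) \<nu>)"
proof -
  note [measurable] = borel_measurable_levy_measure[OF \<nu>]
  have "isCont (\<lambda>z. \<integral>x. levy_integrand (\<lambda>_. 1) z x \<partial>\<nu>) z" for z :: real
    unfolding continuous_at_sequentially comp_def
  proof (intro allI impI)
    fix u :: "nat \<Rightarrow> real" assume u: "u \<longlonglongrightarrow> z"
    then obtain B where B: "\<And>n. norm (u n) \<le> B"
      by (meson Bseq_def convergentI convergent_imp_Bseq)
    show "(\<lambda>n. \<integral>x. levy_integrand (\<lambda>_. 1) (u n) x \<partial>\<nu>) \<longlonglongrightarrow> (\<integral>x. levy_integrand (\<lambda>_. 1) z x \<partial>\<nu>)"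
    proof (rule integral_dominated_convergence)
      show "integrable \<nu> (\<lambda>x. 2 * (1 + B)\<^sup>2 * min ((norm x)\<^sup>2) (norm x))"
        using int by simp
      show "AE x in \<nu>. (\<lambda>n. levy_integrand (\<lambda>_. 1) (u n) x) \<longlonglongrightarrow> levy_integrand (\<lambda>_. 1) z x"
        unfolding levy_integrand_def by (intro AE_I2 tendsto_intros u)
      have "2 * (1 + norm (u n))\<^sup>2 * min ((norm x)\<^sup>2) (norm x) \<le> 2 * (1 + B)\<^sup>2 * min ((norm x)\<^sup>2) (norm x)" for n and x :: real
        using B by (intro mult_right_mono mult_left_mono power_mono) auto
      then show "AE x in \<nu>. norm (levy_integrand (\<lambda>_. 1) (u n) x) \<le> 2 * (1 + B)\<^sup>2 * min ((norm x)\<^sup>2) (norm x)" for n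
        by (intro AE_I2 order_trans[OF norm_levy_integrand_le])
    qed measurable
  qed
  then show ?thesis
    unfolding char_exponent_def inner_real_def
    by (intro continuous_intros) (auto simp: continuous_on_eq_continuous_at intro!: continuous_intros)
qed

text \<open>
  The function \<open>min 1 (norm x)\<^sup>2\<close> is integrable and vanishes only at the origin, which is not in the space;
  so its superlevel sets exhaust the space and have finite measure. Fubini's theorem depends on this.
\<close>

lemma sigma_finite_levy_measure:
  assumes \<nu>: "levy_measure \<nu>"
  shows "sigma_finite_measure \<nu>"
proof
  note [measurable] = borel_measurable_levy_measure[OF \<nu>]
  (* the superlevel sets for 1 / n, in the form used by the Markov inequality *)
  let ?A = "\<lambda>n::nat. {x \<in> space \<nu>. 1 \<le> ennreal (real n) * ennreal (min 1 ((norm x)\<^sup>2))}"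
  have sp: "space \<nu> = - {0}"
    using \<nu> by (auto simp: levy_measure_def space_restrict_space dest!: sets_eq_imp_space_eq)
  show "\<exists>A. countable A \<and> A \<subseteq> sets \<nu> \<and> \<Union> A = space \<nu> \<and> (\<forall>a\<in>A. emeasure \<nu> a \<noteq> \<infinity>)"
  proof (intro exI[of _ "range ?A"] conjI)
    show "range ?A \<subseteq> sets \<nu>"
      by auto
    have "\<exists>n. x \<in> ?A n" if "x \<in> space \<nu>" for x
    proof -
      have "min 1 ((norm x)\<^sup>2) > 0"
        using that by (simp add: sp)
      then obtain n :: nat where "1 < real n * min 1 ((norm x)\<^sup>2)"
        using ex_less_of_nat_mult by blast
      then have "1 \<le> ennreal (real n * min 1 ((norm x)\<^sup>2))"
        by simp
      then show ?thesis
        using that by (auto simp: ennreal_mult intro!: exI[of _ n])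
    qed
    then show "\<Union> (range ?A) = space \<nu>"
      by blast
    show "\<forall>a\<in>range ?A. emeasure \<nu> a \<noteq> \<infinity>"
    proof clarify
      fix n
      assume inf: "emeasure \<nu> (?A n) = \<infinity>"
      have "emeasure \<nu> (?A n) \<le> ennreal (real n) * (\<integral>\<^sup>+ x. ennreal (min 1 ((norm x)\<^sup>2)) * indicator (space \<nu>) x \<partial>\<nu>)"
        by (rule nn_integral_Markov_inequality) auto
      also have "(\<integral>\<^sup>+ x. ennreal (min 1 ((norm x)\<^sup>2)) * indicator (space \<nu>) x \<partial>\<nu>) = (\<integral>\<^sup>+ x. ennreal (min 1 ((norm x)\<^sup>2)) \<partial>\<nu>)"
        by (intro nn_integral_cong) simp
      also have "ennreal (real n) * \<dots> < \<infinity>"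
        using \<nu> by (simp add: levy_measure_def ennreal_mult_less_top)
      finally show False
        using inf by simp
    qed
  qed auto
qed

text \<open>
  As a restricted image measure, \<open>\<Pi>\<close> is subject to the transformation formulas for integrals.
\<close>

lemma kl_levy_measure_eq:
  fixes idx :: "'d::finite \<Rightarrow> nat"
  assumes "sets \<nu> = sets (restrict_space borel (- {0}))"
  shows "kl_levy_measure idx T \<nu> =
    restrict_space (distr (\<nu> \<Otimes>\<^sub>M restrict_space lborel {0..T}) borel (kl_kernel idx T)) (- {0})"
proof (rule measure_eqI)
  let ?N = "\<nu> \<Otimes>\<^sub>M restrict_space lborel {0..T}"
  note [measurable] = measurable_kl_kernel[OF assms]
  show sets: "sets (kl_levy_measure idx T \<nu>) = sets (restrict_space (distr ?N borel (kl_kernel idx T)) (- {0}))"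
    by (simp add: sets_kl_levy_measure sets_restrict_space)
  fix B assume "B \<in> sets (kl_levy_measure idx T \<nu>)"
  then have B: "B \<in> sets (restrict_space borel (- {0}))"
    by (simp add: sets_kl_levy_measure)
  then have sub: "B \<subseteq> - {0}" and [measurable]: "B \<in> sets borel"
    by (auto simp: sets_restrict_space_iff)
  have "emeasure (restrict_space (distr ?N borel (kl_kernel idx T)) (- {0})) B = (\<integral>\<^sup>+ y. indicator B y \<partial>distr ?N borel (kl_kernel idx T))"
    using sub by (subst emeasure_restrict_space) auto
  also have "\<dots> = (\<integral>\<^sup>+ v. indicator B (kl_kernel idx T v) \<partial>?N)"
    by (rule nn_integral_distr) simp_all
  finally show "emeasure (kl_levy_measure idx T \<nu>) B = emeasure (restrict_space (distr ?N borel (kl_kernel idx T)) (- {0})) B"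
    by (simp add: emeasure_kl_levy_measure[OF assms B])
qed

text \<open>
  On \<open>[0, T]\<close> the kernel grows at most linearly in the jump size \<open>x\<close>, so everything on the product space is
  dominated by an integrable function of \<open>x\<close> alone, and the time interval has finite length. The mass that the
  kernel sends to the origin is invisible, since the Levy integrand vanishes there. The last two claims are
  Fubini's theorem for \<open>(x, t) \<mapsto> exp(i \<langle>z, f(x, t)\<rangle>) - 1 - i \<langle>z, f(x, t)\<rangle>\<close>.
\<close>

lemma kl_levy_measure_integrals:
  fixes idx :: "'d::finite \<Rightarrow> nat"
  assumes \<nu>: "levy_measure \<nu>" and int: "integrable \<nu> (\<lambda>x. min ((norm x)\<^sup>2) (norm x))"
  shows "levy_measure (kl_levy_measure idx T \<nu>)"
    and "integrable (kl_levy_measure idx T \<nu>) (levy_integrand (\<lambda>_. 1) z)"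
    and "set_integrable lborel {0..T} (\<lambda>t. \<integral>x. levy_integrand (\<lambda>_. 1) (z \<bullet> kl_kernel idx T (1, t)) x \<partial>\<nu>)"
    and "(LBINT t:{0..T}. \<integral>x. levy_integrand (\<lambda>_. 1) (z \<bullet> kl_kernel idx T (1, t)) x \<partial>\<nu>) =
      (\<integral>y. levy_integrand (\<lambda>_. 1) z y \<partial>kl_levy_measure idx T \<nu>)"
proof -
  let ?L = "restrict_space lborel {0..T}"
  let ?N = "\<nu> \<Otimes>\<^sub>M ?L"
  let ?\<Pi> = "kl_levy_measure idx T \<nu>"
  let ?F = "\<lambda>v. levy_integrand (\<lambda>_. 1) z (kl_kernel idx T v)"
  have sets: "sets \<nu> = sets (restrict_space borel (- {0}))"
    using \<nu> by (simp add: levy_measure_def)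
  interpret \<nu>: sigma_finite_measure \<nu>
    by (rule sigma_finite_levy_measure[OF \<nu>])
  interpret L: finite_measure ?L
    by (rule finite_measureI) (simp add: emeasure_restrict_space emeasure_lborel_Icc_eq space_restrict_space)
  interpret N: pair_sigma_finite \<nu> ?L ..
  have mK [measurable]: "kl_kernel idx T \<in> borel_measurable ?N"
    by (rule measurable_kl_kernel[OF sets])
  have mF [measurable]: "?F \<in> borel_measurable ?N"
    by measurable
  have m\<nu>: "f \<in> borel_measurable \<nu>" if "f \<in> borel_measurable borel" for f :: "real \<Rightarrow> real"
    by (rule borel_measurable_levy_measure[OF \<nu> that])
  have dom: "integrable ?N (\<lambda>v. f (fst v))" if "integrable \<nu> f" for f :: "real \<Rightarrow> real"
  proof (rule N.Fubini_integrable)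
    show "(\<lambda>v. f (fst v)) \<in> borel_measurable ?N"
      using borel_measurable_integrable[OF that] by measurable
    show "integrable \<nu> (\<lambda>x. \<integral>t. norm (f (fst (x, t))) \<partial>?L)"
      using that by (auto intro: integrable_norm)
  qed simp
  obtain C where C: "C \<ge> 1" "\<And>x t. 0 \<le> t \<Longrightarrow> t \<le> T \<Longrightarrow> norm (kl_kernel idx T (x, t)) \<le> C * \<bar>x\<bar>"
    using norm_kl_kernel_le by blast
  have K_le: "norm (kl_kernel idx T v) \<le> C * norm (fst v)" if "v \<in> space ?N" for v
    using that C(2)[of "snd v" "fst v"] by (auto simp: space_pair_measure space_restrict_space)
  have sq_le: "(norm (kl_kernel idx T v))\<^sup>2 \<le> C\<^sup>2 * (norm (fst v))\<^sup>2" if "v \<in> space ?N" for v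
    using power_mono[OF K_le[OF that], of 2] by (simp add: power_mult_distrib)
  have C2: "C \<le> C\<^sup>2" "1 \<le> C\<^sup>2"
    using C(1) self_le_power[of C 2] one_le_power[of C 2] by simp_all

  let ?b = "\<lambda>x::real. min 1 ((norm x)\<^sup>2)"
  have b_int: "integrable \<nu> ?b"
    using \<nu> m\<nu>[of ?b] by (intro integrableI_bounded) (auto simp: levy_measure_def)
  have "(\<integral>\<^sup>+ y. ennreal (min 1 ((norm y)\<^sup>2)) \<partial>?\<Pi>) =
      (\<integral>\<^sup>+ y. ennreal (min 1 ((norm y)\<^sup>2)) * indicator (- {0}) y \<partial>distr ?N borel (kl_kernel idx T))"
    unfolding kl_levy_measure_eq[OF sets] by (rule nn_integral_restrict_space) simp
  also have "\<dots> = (\<integral>\<^sup>+ v. ennreal (min 1 ((norm (kl_kernel idx T v))\<^sup>2)) * indicator (- {0}) (kl_kernel idx T v) \<partial>?N)"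
    by (rule nn_integral_distr) measurable
  also have "\<dots> \<le> (\<integral>\<^sup>+ v. ennreal (C\<^sup>2 * ?b (fst v)) \<partial>?N)"
  proof (rule nn_integral_mono)
    fix v assume v: "v \<in> space ?N"
    have "min 1 ((norm (kl_kernel idx T v))\<^sup>2) \<le> C\<^sup>2 * ?b (fst v)"
      using sq_le[OF v] C2(2) by (simp add: min_def)
    then show "ennreal (min 1 ((norm (kl_kernel idx T v))\<^sup>2)) * indicator (- {0}) (kl_kernel idx T v) \<le> ennreal (C\<^sup>2 * ?b (fst v))"
      by (auto simp: indicator_def intro!: ennreal_leI)
  qed
  also have "\<dots> < \<infinity>"
  proof -
    have "integrable ?N (\<lambda>v. C\<^sup>2 * ?b (fst v))"
      by (intro integrable_mult_right dom[OF b_int])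
    from this[unfolded integrable_iff_bounded, THEN conjunct2] show ?thesis
      by (simp add: abs_mult)
  qed
  finally show "levy_measure ?\<Pi>"
    by (simp add: levy_measure_def sets_kl_levy_measure)

  let ?m = "\<lambda>x::real. min ((norm x)\<^sup>2) (norm x)"
  have F_int: "integrable ?N ?F"
  proof (rule Bochner_Integration.integrable_bound)
    show "integrable ?N (\<lambda>v. 2 * (1 + norm z)\<^sup>2 * (C\<^sup>2 * ?m (fst v)))"
      by (intro integrable_mult_right dom[OF int])
    show "AE v in ?N. norm (?F v) \<le> norm (2 * (1 + norm z)\<^sup>2 * (C\<^sup>2 * ?m (fst v)))"
    proof (rule AE_I2)
      fix v assume v: "v \<in> space ?N"
      have "C * norm (fst v) \<le> C\<^sup>2 * norm (fst v)"
        using C2(1) by (intro mult_right_mono) auto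
      then have "min ((norm (kl_kernel idx T v))\<^sup>2) (norm (kl_kernel idx T v)) \<le> C\<^sup>2 * ?m (fst v)"
        using sq_le[OF v] K_le[OF v] by (simp add: min_def)
      then have "2 * (1 + norm z)\<^sup>2 * min ((norm (kl_kernel idx T v))\<^sup>2) (norm (kl_kernel idx T v)) \<le>
          2 * (1 + norm z)\<^sup>2 * (C\<^sup>2 * ?m (fst v))"
        by (intro mult_left_mono) auto
      then show "norm (?F v) \<le> norm (2 * (1 + norm z)\<^sup>2 * (C\<^sup>2 * ?m (fst v)))"
        using norm_levy_integrand_le[of z "kl_kernel idx T v"] by (simp add: abs_mult)
    qed
  qed measurable
  have [simp]: "levy_integrand (\<lambda>_. 1) z 0 = 0"
    by (simp add: levy_integrand_def)
  have distr_int: "integrable (distr ?N borel (kl_kernel idx T)) (levy_integrand (\<lambda>_. 1) z)"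
    using F_int by (simp add: integrable_distr_eq)
  have ind: "(\<lambda>y. indicator (- {0}) y *\<^sub>R levy_integrand (\<lambda>_. 1) z y) = levy_integrand (\<lambda>_. 1) z"
    by (auto simp: fun_eq_iff indicator_def)
  show "integrable ?\<Pi> (levy_integrand (\<lambda>_. 1) z)"
    unfolding kl_levy_measure_eq[OF sets] using distr_int
    by (subst integrable_restrict_space) (simp_all add: ind)
  have \<Pi>_val: "(\<integral>y. levy_integrand (\<lambda>_. 1) z y \<partial>?\<Pi>) = integral\<^sup>L ?N ?F"
    unfolding kl_levy_measure_eq[OF sets]
    by (subst integral_restrict_space) (simp_all add: ind integral_distr)
  have F_pair: "(\<lambda>(x, t). ?F (x, t)) = ?F"
    by (simp add: fun_eq_iff)
  have slice: "?F (x, t) = levy_integrand (\<lambda>_. 1) (z \<bullet> kl_kernel idx T (1, t)) x" for x t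
    unfolding levy_integrand_def kl_kernel_scaleR[of idx T x t] by (simp add: mult.commute)
  have int_t: "integrable ?L (\<lambda>t. \<integral>x. levy_integrand (\<lambda>_. 1) (z \<bullet> kl_kernel idx T (1, t)) x \<partial>\<nu>)"
    using N.integrable_snd[of "\<lambda>x t. ?F (x, t)", unfolded F_pair, OF F_int] by (simp only: slice)
  then show "set_integrable lborel {0..T} (\<lambda>t. \<integral>x. levy_integrand (\<lambda>_. 1) (z \<bullet> kl_kernel idx T (1, t)) x \<partial>\<nu>)"
    unfolding set_integrable_def by (subst (asm) integrable_restrict_space) auto
  have "(LBINT t:{0..T}. \<integral>x. levy_integrand (\<lambda>_. 1) (z \<bullet> kl_kernel idx T (1, t)) x \<partial>\<nu>) =
      (\<integral>t. \<integral>x. ?F (x, t) \<partial>\<nu> \<partial>?L)"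
    unfolding set_lebesgue_integral_def by (subst integral_restrict_space) (auto simp: slice)
  also have "\<dots> = integral\<^sup>L ?N ?F"
    by (rule N.integral_snd[of "\<lambda>x t. ?F (x, t)", unfolded F_pair, OF F_int])
  finally show "(LBINT t:{0..T}. \<integral>x. levy_integrand (\<lambda>_. 1) (z \<bullet> kl_kernel idx T (1, t)) x \<partial>\<nu>) =
      (\<integral>y. levy_integrand (\<lambda>_. 1) z y \<partial>?\<Pi>)"
    by (simp only: \<Pi>_val)
qed

section \<open>Orthogonality of the cosines\<close>

lemma integral_cos_half_period:
  assumes "T > 0"
  shows "has_bochner_integral lborel (\<lambda>t. indicator {0..T} t *\<^sub>R cos (pi / T * real_of_int p * t)) (if p = 0 then T else 0)"
proof (cases "p = 0")
  case True
  have "has_bochner_integral lborel (indicator {0..T} :: real \<Rightarrow> real) (measure lborel {0..T})"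
    by (intro has_bochner_integral_real_indicator) (auto simp: emeasure_lborel_Icc_eq)
  then show ?thesis
    using True assms by simp
next
  case False
  let ?a = "pi / T * real_of_int p"
  have a: "?a \<noteq> 0"
    using False assms by simp
  have "has_bochner_integral lborel (\<lambda>t. indicator {0..T} t *\<^sub>R cos (?a * t)) (sin (?a * T) / ?a - sin (?a * 0) / ?a)"
  proof (rule has_bochner_integral_FTC_Icc)
    fix t
    show "((\<lambda>t. sin (?a * t) / ?a) has_vector_derivative cos (?a * t)) (at t within {0..T})"
      unfolding has_real_derivative_iff_has_vector_derivative[symmetric]
      using a by (auto intro!: derivative_eq_intros simp del: times_divide_eq_left times_divide_eq_right)
  qed (use assms in \<open>auto intro!: continuous_intros\<close>)
  moreover have "sin (?a * T) = 0"
    using assms by (simp add: sin_zero_iff_int2)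
  ultimately show ?thesis
    using False by simp
qed

text \<open>
  By the product formula for cosines the frequencies become \<open>k - l\<close> and \<open>k + l - 1\<close> half-periods. The
  second is never \<open>0\<close> for indices starting at \<open>1\<close>, and the first only on the diagonal.
\<close>

lemma integral_kl_kernel_product:
  fixes idx :: "'d::finite \<Rightarrow> nat"
  assumes "T > 0" "inj idx" and pos: "\<And>j. idx j \<ge> 1"
  shows "has_bochner_integral lborel
    (\<lambda>t. indicator {0..T} t *\<^sub>R (kl_kernel idx T (1, t) $ i * kl_kernel idx T (1, t) $ j))
    (if i = j then T\<^sup>2 / (pi\<^sup>2 * (real (idx i) - 1 / 2)\<^sup>2) else 0)"
proof -
  let ?r = "\<lambda>j. real (idx j) - 1 / 2"
  let ?c = "2 * T / (pi\<^sup>2 * ?r i * ?r j)"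
  let ?p = "int (idx i) - int (idx j)" and ?q = "int (idx i) + int (idx j) - 1"
  have q: "?q \<noteq> 0"
    using pos[of i] pos[of j] by linarith
  have p: "?p = 0 \<longleftrightarrow> i = j"
    using \<open>inj idx\<close> by (auto dest: injD)
  have r: "?r j \<noteq> 0" for j
    using pos[of j] by linarith
  have "has_bochner_integral lborel (\<lambda>t. ?c * (1/2 * (indicator {0..T} t *\<^sub>R cos (pi / T * real_of_int ?p * t) +
      indicator {0..T} t *\<^sub>R cos (pi / T * real_of_int ?q * t)))) (?c * (1/2 * ((if ?p = 0 then T else 0) + (if ?q = 0 then T else 0))))"
    by (intro has_bochner_integral_mult_right has_bochner_integral_add integral_cos_half_period \<open>T > 0\<close>)
  moreover have "?c * (1/2 * (indicator {0..T} t *\<^sub>R cos (pi / T * real_of_int ?p * t) + indicator {0..T} t *\<^sub>R cos (pi / T * real_of_int ?q * t)))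
      = indicator {0..T} t *\<^sub>R (kl_kernel idx T (1, t) $ i * kl_kernel idx T (1, t) $ j)" for t
  proof -
    have pq: "pi / T * real_of_int ?p * t = pi / T * ?r i * t - pi / T * ?r j * t"
      "pi / T * real_of_int ?q * t = pi / T * ?r i * t + pi / T * ?r j * t"
      by (simp_all add: algebra_simps)
    have "sqrt (2 * T) * sqrt (2 * T) = 2 * T"
      using \<open>T > 0\<close> by simp
    moreover have "kl_kernel idx T (1, t) $ i * kl_kernel idx T (1, t) $ j =
        sqrt (2 * T) * sqrt (2 * T) / (pi\<^sup>2 * ?r i * ?r j) * (cos (pi / T * ?r i * t) * cos (pi / T * ?r j * t))"
      by (simp add: kl_kernel_def power2_eq_square mult_ac del: real_sqrt_mult_self)
    ultimately have "kl_kernel idx T (1, t) $ i * kl_kernel idx T (1, t) $ j = ?c * (cos (pi / T * ?r i * t) * cos (pi / T * ?r j * t))"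
      by (simp only:)
    moreover have "c * (1/2 * (k *\<^sub>R (a * b + s) + k *\<^sub>R (a * b - s))) = k *\<^sub>R (c * (a * b))" for c k a b s :: real
      by (simp add: algebra_simps)
    ultimately show ?thesis
      unfolding pq cos_diff cos_add by (simp only:)
  qed
  moreover have "?c * (1/2 * ((if ?p = 0 then T else 0) + (if ?q = 0 then T else 0))) =
      (if i = j then T\<^sup>2 / (pi\<^sup>2 * (real (idx i) - 1 / 2)\<^sup>2) else 0)"
    using q p by (simp add: power2_eq_square)
  ultimately show ?thesis
    by simp
qed

lemma kl_covariance_mult: "(kl_covariance idx \<sigma> T *v x) $ i = \<sigma>\<^sup>2 * (T\<^sup>2 / (pi\<^sup>2 * (real (idx i) - 1 / 2)\<^sup>2)) * x $ i"
  by (simp add: kl_covariance_def matrix_vector_mult_def if_distrib[of "\<lambda>x. x * _"] cong: if_cong)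

lemma integral_kl_kernel_quadratic_form:
  fixes idx :: "'d::finite \<Rightarrow> nat"
  assumes "T > 0" "inj idx" "\<And>j. idx j \<ge> 1"
  shows "\<sigma>\<^sup>2 * (LBINT t:{0..T}. (z \<bullet> kl_kernel idx T (1, t))\<^sup>2) = z \<bullet> (kl_covariance idx \<sigma> T *v z)"
proof -
  let ?g = "\<lambda>t j. kl_kernel idx T (1, t) $ j"
  let ?v = "\<lambda>i. T\<^sup>2 / (pi\<^sup>2 * (real (idx i) - 1 / 2)\<^sup>2)"
  have "has_bochner_integral lborel (\<lambda>t. \<Sum>i\<in>UNIV. \<Sum>j\<in>UNIV. z $ i * z $ j * (indicator {0..T} t *\<^sub>R (?g t i * ?g t j)))
     (\<Sum>i\<in>UNIV. \<Sum>j\<in>UNIV. z $ i * z $ j * (if i = j then ?v i else 0))"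
    by (intro has_bochner_integral_sum has_bochner_integral_mult_right integral_kl_kernel_product assms)
  moreover have "(\<Sum>i\<in>UNIV. \<Sum>j\<in>UNIV. z $ i * z $ j * (indicator {0..T} t *\<^sub>R (?g t i * ?g t j))) =
     indicator {0..T} t *\<^sub>R (z \<bullet> kl_kernel idx T (1, t))\<^sup>2" for t
    unfolding power2_eq_square inner_vec_def inner_real_def sum_product scaleR_sum_right
    by (intro sum.cong refl) simp
  moreover have "(\<Sum>i\<in>UNIV. \<Sum>j\<in>UNIV. z $ i * z $ j * (if i = j then ?v i else 0)) = (\<Sum>i\<in>UNIV. (z $ i)\<^sup>2 * ?v i)"
    by (simp add: power2_eq_square if_distrib[of "\<lambda>x. _ * x"] cong: if_cong)
  ultimately have "(LBINT t:{0..T}. (z \<bullet> kl_kernel idx T (1, t))\<^sup>2) = (\<Sum>i\<in>UNIV. (z $ i)\<^sup>2 * ?v i)"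
    unfolding set_lebesgue_integral_def by (simp add: has_bochner_integral_iff)
  moreover have "z \<bullet> (kl_covariance idx \<sigma> T *v z) = (\<Sum>i\<in>UNIV. \<sigma>\<^sup>2 * ((z $ i)\<^sup>2 * ?v i))"
    by (simp add: inner_vec_def kl_covariance_mult power2_eq_square mult_ac)
  ultimately show ?thesis
    by (simp add: sum_distrib_left)
qed

section \<open>The generating triple of the coefficients\<close>

lemma integral_char_exponent_kl_kernel:
  fixes idx :: "'d::finite \<Rightarrow> nat"
  assumes "T > 0" "inj idx" "\<And>j. idx j \<ge> 1"
    and \<nu>: "levy_measure \<nu>" and int: "integrable \<nu> (\<lambda>x. min ((norm x)\<^sup>2) (norm x))"
  shows "(LBINT t:{0..T}. char_exponent (\<lambda>_. 1) 0 (\<lambda>z. \<sigma>\<^sup>2 * z) \<nu> (z \<bullet> kl_kernel idx T (1, t))) =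
    char_exponent (\<lambda>_. 1) 0 (\<lambda>z. kl_covariance idx \<sigma> T *v z) (kl_levy_measure idx T \<nu>) z"
proof -
  let ?q = "\<lambda>t. z \<bullet> kl_kernel idx T (1, t)"
  let ?I = "\<lambda>t. \<integral>x. levy_integrand (\<lambda>_. 1) (?q t) x \<partial>\<nu>"
  have "(LBINT t:{0..T}. char_exponent (\<lambda>_. 1) 0 (\<lambda>z. \<sigma>\<^sup>2 * z) \<nu> (?q t)) =
      (LBINT t:{0..T}. complex_of_real (\<sigma>\<^sup>2 * (?q t)\<^sup>2 / 2) - ?I t)"
    by (simp add: char_exponent_def power2_eq_square mult_ac)
  also have "\<dots> = (LBINT t:{0..T}. complex_of_real (\<sigma>\<^sup>2 * (?q t)\<^sup>2 / 2)) - (LBINT t:{0..T}. ?I t)"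
  proof (rule set_integral_diff(2))
    show "set_integrable lborel {0..T} (\<lambda>t. complex_of_real (\<sigma>\<^sup>2 * (?q t)\<^sup>2 / 2))"
      by (intro borel_integrable_atLeastAtMost' continuous_intros) auto
  qed (rule kl_levy_measure_integrals(3)[OF \<nu> int])
  also have "(LBINT t:{0..T}. complex_of_real (\<sigma>\<^sup>2 * (?q t)\<^sup>2 / 2)) = complex_of_real ((LBINT t:{0..T}. \<sigma>\<^sup>2 * (?q t)\<^sup>2 / 2))"
    by (rule set_integral_complex_of_real)
  also have "(LBINT t:{0..T}. \<sigma>\<^sup>2 * (?q t)\<^sup>2 / 2) = (z \<bullet> (kl_covariance idx \<sigma> T *v z)) / 2"
    using integral_kl_kernel_quadratic_form[OF assms(1-3), of \<sigma> z]
    by simp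
  finally show ?thesis
    by (simp add: kl_levy_measure_integrals(4)[OF \<nu> int] char_exponent_def)
qed

theorem theorem2:
  fixes M :: "'a measure" and X :: "real \<Rightarrow> 'a \<Rightarrow> real"
    and T \<sigma> :: real and \<nu> :: "real measure"
    and idx :: "'d::finite \<Rightarrow> nat"
  assumes "T > 0"
    and "bij_betw idx UNIV {1..CARD('d)}"
    and "class_K M X"
    and "process_has_triple M X (\<lambda>_. 1) 0 (\<lambda>z. \<sigma>\<^sup>2 * z) \<nu>"
  shows "class_C (completion M) (kl_vector idx X T) \<and>
    vector_has_triple (completion M) (kl_vector idx X T)
      (\<lambda>_. 1) 0 (\<lambda>z. kl_covariance idx \<sigma> T *v z) (kl_levy_measure idx T \<nu>)"
proof -
  let ?\<psi> = "char_exponent (\<lambda>_. 1) 0 (\<lambda>z. \<sigma>\<^sup>2 * z) \<nu>"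
  have idx: "inj idx" "idx j \<ge> 1" for j
    using assms(2) by (auto simp: bij_betw_def)
  have \<nu>: "levy_measure \<nu>" and "integrable \<nu> (levy_integrand (\<lambda>_. 1) 1)"
    using assms(4) by (auto simp: process_has_triple_def generating_triple_def)
  then have int: "integrable \<nu> (\<lambda>x. min ((norm x)\<^sup>2) (norm x))"
    by (rule integrable_min_square_norm)
  have lp: "levy_process M X"
    using assms(3) by (simp add: class_K_def)
  have char: "(\<integral>\<omega>. iexp (z * X t \<omega>) \<partial>M) = exp (- (complex_of_real t * ?\<psi> z))" if "t \<ge> 0" for t z
    using assms(4) that by (simp add: process_has_triple_def)
  note cont = continuous_on_char_exponent[OF \<nu> int, of \<sigma>]
  have "generating_triple (\<lambda>_. 1) 0 (\<lambda>z. kl_covariance idx \<sigma> T *v z) (kl_levy_measure idx T \<nu>)"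
    unfolding generating_triple_def
  proof (intro conjI allI)
    show "linear (\<lambda>z. kl_covariance idx \<sigma> T *v z)"
      by (rule matrix_vector_mul_linear)
    show "(kl_covariance idx \<sigma> T *v x) \<bullet> y = x \<bullet> (kl_covariance idx \<sigma> T *v y)" for x y
      by (simp add: inner_vec_def kl_covariance_mult mult_ac)
    show "0 \<le> x \<bullet> (kl_covariance idx \<sigma> T *v x)" for x
    proof -
      have "x \<bullet> (kl_covariance idx \<sigma> T *v x) =
          (\<Sum>i\<in>UNIV. \<sigma>\<^sup>2 * (T\<^sup>2 / (pi\<^sup>2 * (real (idx i) - 1 / 2)\<^sup>2)) * (x $ i)\<^sup>2)"
        by (simp add: inner_vec_def kl_covariance_mult power2_eq_square mult_ac)
      also have "\<dots> \<ge> 0"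
        by (intro sum_nonneg mult_nonneg_nonneg divide_nonneg_nonneg) auto
      finally show ?thesis .
    qed
  qed (rule kl_levy_measure_integrals[OF \<nu> int])+
  moreover have "(\<integral>\<omega>. iexp (z \<bullet> kl_vector idx X T \<omega>) \<partial>completion M) =
      exp (- char_exponent (\<lambda>_. 1) 0 (\<lambda>z. kl_covariance idx \<sigma> T *v z) (kl_levy_measure idx T \<nu>) z)" for z
    unfolding integral_char_exponent_kl_kernel[OF assms(1) idx \<nu> int, symmetric]
    by (rule char_kl_vector[OF lp assms(1) char cont])
  ultimately show ?thesis
    using class_C_kl_vector[OF assms(3,1) char cont, of idx] by (simp add: vector_has_triple_def)
qed

end
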